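(* Let $R(\lambda)\in\mathbb{F}(\lambda)^{p\times m}$ be a rational matrix expressed in the form $R(\lambda)=D(\lambda)+C(\lambda)A(\lambda)^{-1}B(\lambda)$, for some nonsingular polynomial matrix $A(\lambda)\in\mathbb{F}[\lambda]^{n\times n}$ and polynomial matrices $B(\lambda)\in\mathbb{F}[\lambda]^{n\times m}$, $C(\lambda)\in\mathbb{F}[\lambda]^{p\times n}$ and $D(\lambda)\in\mathbb{F}[\lambda]^{p\times m}$. Let $$L_A(\lambda)=\begin{bmatrix} M_A(\lambda)\\ K_A(\lambda)\end{bmatrix}\quad\text{and}\quad L_D(\lambda)=\begin{bmatrix} M_D(\lambda)\\ K_D(\lambda)\end{bmatrix}$$ be block minimal basis pencils (linearizations) associated with $A(\lambda)$ and $D(\lambda)$, respectively, where $K_A(\lambda)$ has $k_A$ rows and $n+k_A$ columns and $K_D(\lambda)$ has $k_D$ rows and $m+k_D$ columns. Let $N_A(\lambda)$ and $N_D(\lambda)$ be minimal bases dual to $K_A(\lambda)$ and $K_D(\lambda)$, respectively, with $M_A(\lambda)N_A(\lambda)^T=A(\lambda)$ and $M_D(\lambda)N_D(\lambda)^T=D(\lambda)$. Consider linear polynomial matrices $M_C(\lambda)\in\mathbb{F}[\lambda]^{p\times(n+k_A)}$ and $M_B(\lambda)\in\mathbb{F}[\lambda]^{n\times(m+k_D)}$ such that $$M_C(\lambda)N_A(\lambda)^T=C(\lambda)\quad\text{and}\quad M_B(\lambda)N_D(\lambda)^T=B(\lambda),$$ and the linear polynomial system matrix $$\mathcal{L}(\lambda)=\left[\begin{array}{c|c}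 M_A(\lambda) & M_B(\lambda)\\ K_A(\lambda) & 0\\ \hline -M_C(\lambda) & M_D(\lambda)\\ 0 & K_D(\lambda)\end{array}\right]$$ with state matrix $L_A(\lambda)$. If the matrices $$\begin{bmatrix} A(\lambda)\\ C(\lambda)\end{bmatrix}\quad\text{and}\quad\begin{bmatrix} A(\lambda) & B(\lambda)\end{bmatrix}$$ have no eigenvalues in $\Omega\subseteq\mathbb{F}$, then $\mathcal{L}(\lambda)$ is a linearization of $R(\lambda)$ in $\Omega$.
   Context: $\mathbb{F}$ is an algebraically closed field (not including infinity); $\mathbb{F}[\lambda]$ and $\mathbb{F}(\lambda)$ are the polynomials and rational functions over $\mathbb{F}$. A polynomial matrix is linear if all its entries have degree at most $1$. For a rational matrix $G(\lambda)$, $\operatorname{rank} G(\lambda)$ is its rank over $\mathbb{F}(\lambda)$, and $\operatorname{rank} G(\lambda_0)$ is the rank over $\mathbb{F}$ of the constant matrix $G(\lambda_0)$. A scalar $\lambda_0\in\mathbb{F}$ is an eigenvalue of a polynomial matrix $G(\lambda)$ if $\operatorname{rank} G(\lambda_0)<\operatorname{rank} G(\lambda)$. A rational matrix is regular in $\Omega\subseteq\mathbb{F}$ if it is square and, for every $\lambda_0\in\Omega$, its value at $\lambda_0$ has finite entries and is invertible. Minimal bases: a minimal basis of a subspace $\mathcal{V}$ of $\mathbb{F}(\lambda)^{N}$ is a basis of $\mathcal{V}$ consisting of polynomial vectors whose sum of degrees is minimal among all polynomial bases of $\mathcal{V}$. A polynomial matrix with fewer rows than columns is called a minimal basis if its rows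 form a minimal basis of the subspace they span. Minimal bases $K(\lambda)\in\mathbb{F}[\lambda]^{k\times l}$ and $N(\lambda)\in\mathbb{F}[\lambda]^{q\times l}$ are dual if $k+q=l$ and $K(\lambda)N(\lambda)^T=0$. Block minimal basis pencil (degenerate form, the only one used here): a linear polynomial matrix $\begin{bmatrix} M(\lambda)\\ K(\lambda)\end{bmatrix}$ where $K(\lambda)$ is a minimal basis. It is associated with a polynomial matrix $P(\lambda)$ (and is then called a block minimal basis linearization of $P(\lambda)$) if $M(\lambda)N(\lambda)^T=P(\lambda)$, where $N(\lambda)$ is a minimal basis dual to $K(\lambda)$. Polynomial system matrices: for polynomial matrices $\mathsf{A}$ (square, of size $\nu>0$, regular, i.e. $\det \mathsf{A}\not\equiv 0$), $\mathsf{B},\mathsf{C},\mathsf{D}$ of compatible sizes, $\begin{bmatrix}\mathsf{A}(\lambda)&\mathsf{B}(\lambda)\\-\mathsf{C}(\lambda)&\mathsf{D}(\lambda)\end{bmatrix}$ is a polynomial system matrix with state matrix $\mathsf{A}(\lambda)$ and transfer function matrix $\mathsf{D}(\lambda)+\mathsf{C}(\lambda)\mathsf{A}(\lambda)^{-1}\mathsf{B}(\lambda)$. It is minimal in $\Omega\subseteq\mathbb{F}$ if $\begin{bmatrix}\mathsf{A}(\lambda)\\ \mathsf{C}(\lambda)\end{bmatrix}$ and $\begin{bmatrix}\mathsf{A}(\lambda)&\mathsf{B}(\lambda)\end{bmatrix}$ have no eigenvalues in $\Omega$. Linearization in a set: let $R(\lambda)\in\mathbb{F}(\lambda)^{p\times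 m}$ and let $\mathcal{L}(\lambda)\in\mathbb{F}[\lambda]^{(\nu+p+s)\times(\nu+m+s)}$ be a linear polynomial system matrix with $\nu\times\nu$ state matrix and transfer function matrix $\widehat R(\lambda)\in\mathbb{F}(\lambda)^{(p+s)\times(m+s)}$. Then $\mathcal{L}(\lambda)$ is a linearization of $R(\lambda)$ in $\Omega\subseteq\mathbb{F}$ if (a) $\mathcal{L}(\lambda)$ is minimal in $\Omega$, and (b) there exist rational matrices $R_1(\lambda)$ and $R_2(\lambda)$, both regular in $\Omega$, such that $R_1(\lambda)\begin{bmatrix}R(\lambda)&0\\0&I_s\end{bmatrix}R_2(\lambda)=\widehat R(\lambda)$. *)

theory Defs
  imports
    "HOL-Computational_Algebra.Polynomial_Factorial"
    "Jordan_Normal_Form.Gauss_Jordan_Elimination"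
    "Jordan_Normal_Form.DL_Rank"
begin

text \<open>
  Polynomial matrices have type \<^typ>\<open>'a poly mat\<close>, rational matrices have type
  \<^typ>\<open>'a poly fract mat\<close>.
\<close>

abbreviation rat_vec :: "'a::field poly vec \<Rightarrow> 'a poly fract vec" where
  "rat_vec \<equiv> map_vec to_fract"

abbreviation rat_mat :: "'a::field poly mat \<Rightarrow> 'a poly fract mat" where
  "rat_mat \<equiv> map_mat to_fract"

definition append_cols :: "'a::zero mat \<Rightarrow> 'a mat \<Rightarrow> 'a mat" (infixr "@\<^sub>c" 65) where
  "A @\<^sub>c B = four_block_mat A B (0\<^sub>m 0 (dim_col A)) (0\<^sub>m 0 (dim_col B))"

definition linear_poly_mat :: "'a::field poly mat \<Rightarrow> bool" where
  "linear_poly_mat G \<longleftrightarrow> (\<forall>i<dim_row G. \<forall>j<dim_col G. degree (G $$ (i, j)) \<le> 1)"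


subsection \<open>Ranks, eigenvalues and regularity in a set\<close>

definition normal_rank :: "'a::field poly mat \<Rightarrow> nat" where
  "normal_rank G = vec_space.rank (dim_row G) (rat_mat G)"

definition rank_at :: "'a::field poly mat \<Rightarrow> 'a \<Rightarrow> nat" where
  "rank_at G x = vec_space.rank (dim_row G) (map_mat (\<lambda>q. poly q x) G)"

definition poly_mat_eigenvalue :: "'a::field poly mat \<Rightarrow> 'a \<Rightarrow> bool" where
  "poly_mat_eigenvalue G x \<longleftrightarrow> rank_at G x < normal_rank G"

definition no_eigenvalues_in :: "'a::field set \<Rightarrow> 'a poly mat \<Rightarrow> bool" where
  "no_eigenvalues_in \<Omega> G \<longleftrightarrow> (\<forall>x\<in>\<Omega>. \<not> poly_mat_eigenvalue G x)"

text \<open>The rational function \<open>r\<close> is finite at \<open>x\<close> and takes the value \<open>v\<close> there.\<close>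

definition has_value_at :: "'a::field poly fract \<Rightarrow> 'a \<Rightarrow> 'a \<Rightarrow> bool" where
  "has_value_at r x v \<longleftrightarrow>
     (\<exists>a b. poly b x \<noteq> 0 \<and> r = to_fract a / to_fract b \<and> v = poly a x / poly b x)"

definition regular_in :: "'a::field set \<Rightarrow> 'a poly fract mat \<Rightarrow> bool" where
  "regular_in \<Omega> G \<longleftrightarrow> square_mat G \<and>
     (\<forall>x\<in>\<Omega>. \<exists>V \<in> carrier_mat (dim_row G) (dim_col G).
        (\<forall>i<dim_row G. \<forall>j<dim_col G. has_value_at (G $$ (i, j)) x (V $$ (i, j))) \<and>
        invertible_mat V)"


subsection \<open>Minimal bases and block minimal basis pencils\<close>

text \<open>
  The degree of a polynomial vector is the largest degree of its entries. The inserted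
  \<open>0\<close> only matters for the vector of dimension \<open>0\<close>.
\<close>

definition vec_degree :: "'a::field poly vec \<Rightarrow> nat" where
  "vec_degree v = Max (insert 0 (degree ` set\<^sub>v v))"

text \<open>
  Bases are listed without repetition, so that the rows of a matrix can be used directly.
  Independence and span are those of the vector space of rational vectors of dimension \<open>l\<close>.
\<close>

definition polynomial_basis ::
    "nat \<Rightarrow> 'a::field poly fract vec set \<Rightarrow> 'a poly vec list \<Rightarrow> bool" where
  "polynomial_basis l V bs \<longleftrightarrow>
     set bs \<subseteq> carrier_vec l \<and> distinct bs \<and>
     \<not> LinearCombinations.module.lin_dep class_ring (module_vec TYPE('a poly fract) l)
         (rat_vec ` set bs) \<and>
     LinearCombinations.module.span class_ring (module_vec TYPE('a poly fract) l)
         (rat_vec ` set bs) = V"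

definition minimal_polynomial_basis ::
    "nat \<Rightarrow> 'a::field poly fract vec set \<Rightarrow> 'a poly vec list \<Rightarrow> bool" where
  "minimal_polynomial_basis l V bs \<longleftrightarrow>
     polynomial_basis l V bs \<and>
     (\<forall>cs. polynomial_basis l V cs \<longrightarrow>
        sum_list (map vec_degree bs) \<le> sum_list (map vec_degree cs))"

definition minimal_basis :: "'a::field poly mat \<Rightarrow> bool" where
  "minimal_basis K \<longleftrightarrow>
     dim_row K < dim_col K \<and>
     minimal_polynomial_basis (dim_col K)
       (LinearCombinations.module.span class_ring (module_vec TYPE('a poly fract) (dim_col K))
          (rat_vec ` set (rows K)))
       (rows K)"

definition dual_minimal_bases :: "'a::field poly mat \<Rightarrow> 'a poly mat \<Rightarrow> bool" where
  "dual_minimal_bases K N \<longleftrightarrow>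
     minimal_basis K \<and> minimal_basis N \<and>
     dim_col N = dim_col K \<and> dim_row K + dim_row N = dim_col K \<and>
     K * N\<^sup>T = 0\<^sub>m (dim_row K) (dim_row N)"

definition block_minimal_basis_pencil :: "'a::field poly mat \<Rightarrow> 'a poly mat \<Rightarrow> bool" where
  "block_minimal_basis_pencil M K \<longleftrightarrow>
     dim_col M = dim_col K \<and> linear_poly_mat (M @\<^sub>r K) \<and> minimal_basis K"

text \<open>
  \<open>N\<close> is the dual minimal basis through which the pencil with blocks \<open>M\<close> and \<open>K\<close>
  is associated with \<open>P\<close>.
\<close>

definition block_minimal_basis_linearization ::
    "'a::field poly mat \<Rightarrow> 'a poly mat \<Rightarrow> 'a poly mat \<Rightarrow> 'a poly mat \<Rightarrow> bool" where
  "block_minimal_basis_linearization M K N P \<longleftrightarrow>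
     block_minimal_basis_pencil M K \<and> dual_minimal_bases K N \<and> M * N\<^sup>T = P"


subsection \<open>Polynomial system matrices and linearizations in a set\<close>

definition system_matrix ::
    "'a::field poly mat \<Rightarrow> 'a poly mat \<Rightarrow> 'a poly mat \<Rightarrow> 'a poly mat \<Rightarrow> 'a poly mat" where
  "system_matrix A B C D = four_block_mat A B (- C) D"

definition is_system_matrix ::
    "nat \<Rightarrow> nat \<Rightarrow> nat \<Rightarrow>
     'a::field poly mat \<Rightarrow> 'a poly mat \<Rightarrow> 'a poly mat \<Rightarrow> 'a poly mat \<Rightarrow> bool" where
  "is_system_matrix \<nu> p m A B C D \<longleftrightarrow>
     0 < \<nu> \<and> A \<in> carrier_mat \<nu> \<nu> \<and> det A \<noteq> 0 \<and>
     B \<in> carrier_mat \<nu> m \<and> C \<in> carrier_mat p \<nu> \<and> D \<in> carrier_mat p m"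

text \<open>Only used for square \<open>A\<close> with \<^prop>\<open>det A \<noteq> 0\<close>, where the inverse exists.\<close>

definition transfer_function ::
    "'a::field poly mat \<Rightarrow> 'a poly mat \<Rightarrow> 'a poly mat \<Rightarrow> 'a poly mat \<Rightarrow> 'a poly fract mat" where
  "transfer_function A B C D =
     rat_mat D + rat_mat C * the (mat_inverse (rat_mat A)) * rat_mat B"

definition minimal_in ::
    "'a::field set \<Rightarrow> 'a poly mat \<Rightarrow> 'a poly mat \<Rightarrow> 'a poly mat \<Rightarrow> bool" where
  "minimal_in \<Omega> A B C \<longleftrightarrow> no_eigenvalues_in \<Omega> (A @\<^sub>r C) \<and> no_eigenvalues_in \<Omega> (A @\<^sub>c B)"

text \<open>
  The number \<open>\<nu>\<close> fixes the partition of \<open>L\<close>: the state matrix is the leading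
  \<open>\<nu> \<times> \<nu>\<close> block, so the existentially quantified \<open>A\<close>, \<open>B\<close>, \<open>C\<close>, \<open>D\<close> and \<open>s\<close> are
  determined by \<open>\<nu>\<close>, \<open>L\<close> and the size of \<open>R\<close>.
\<close>

definition linearization_in ::
    "'a::field set \<Rightarrow> nat \<Rightarrow> 'a poly mat \<Rightarrow> 'a poly fract mat \<Rightarrow> bool" where
  "linearization_in \<Omega> \<nu> L R \<longleftrightarrow>
     (\<exists>s A B C D.
        is_system_matrix \<nu> (dim_row R + s) (dim_col R + s) A B C D \<and>
        L = system_matrix A B C D \<and>
        linear_poly_mat L \<and>
        minimal_in \<Omega> A B C \<and>
        (\<exists>R1 \<in> carrier_mat (dim_row R + s) (dim_row R + s).
         \<exists>R2 \<in> carrier_mat (dim_col R + s) (dim_col R + s).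
           regular_in \<Omega> R1 \<and> regular_in \<Omega> R2 \<and>
           R1 * four_block_mat R (0\<^sub>m (dim_row R) s) (0\<^sub>m s (dim_col R)) (1\<^sub>m s) * R2 =
             transfer_function A B C D))"

end

theory Submission
  imports Defs "Subresultants.More_Homomorphisms"
begin

text \<open>
  The proof rests on two facts about coprimeness.

  The first one concerns a minimal basis \<open>K\<close> and a dual minimal basis \<open>N\<close>. The values of a minimal
  basis have full row rank at every point: otherwise a combination of the rows would be divisible
  by some \<open>X - x\<close>, and dividing by it would lower the degrees
  (\<open>minimal_basis_rows_independent_at\<close>). Over an algebraically closed field this yields polynomial
  right inverses of \<open>K\<close> and \<open>N\<close>, and from these polynomial matrices \<open>U\<close>, \<open>W\<close> such that the matrix with
  block rows \<open>U, K\<close> and the matrix with block columns \<open>N\<^sup>T, W\<close> are inverse to each other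
  (\<open>dual_minimal_bases_completion\<close>).

  The second one is a Bezout identity. As the matrix with blocks \<open>A, B\<close> has no eigenvalues in \<open>\<Omega>\<close>,
  there are polynomial matrices \<open>S\<close>, \<open>T\<close> and a polynomial \<open>g\<close> without zeros in \<open>\<Omega>\<close> such that
  \<open>A S + B T = g I\<close> (\<open>bezout_identity\<close>).

  Minimality of the system matrix in \<open>\<Omega>\<close> follows quickly. By the completion for \<open>K\<^sub>A\<close>, a vector \<open>v\<close> in
  the kernel of \<open>K\<^sub>A(x)\<close> equals \<open>N\<^sub>A(x)\<^sup>T w\<close> for some \<open>w\<close>, and \<open>M\<^sub>A(x) v = A(x) w\<close> and \<open>M\<^sub>C(x) v = C(x) w\<close>; so
  the kernel condition for the system matrix is the one for \<open>A\<close> and \<open>C\<close>. Dually, the Bezout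
  identity gives right inverses of the values of the upper block row.

  For the transfer function, the equation \<open>L\<^sub>A N\<^sub>A\<^sup>T = (A, 0)\<close> shows that it equals the matrix with
  block rows \<open>M\<^sub>D + C A\<^sup>-\<^sup>1 M\<^sub>B\<close> and \<open>K\<^sub>D\<close> (\<open>transfer_function_reduction\<close>). Its product with the
  unimodular matrix of block columns \<open>N\<^sub>D\<^sup>T, W\<^sub>D\<close> is block triangular with diagonal blocks \<open>R\<close> and
  \<open>I\<close>, but the remaining block contains \<open>C A\<^sup>-\<^sup>1\<close>, which may have poles in \<open>\<Omega>\<close>. The Bezout identity
  rewrites this block as \<open>Z + R T Y / g\<close> with \<open>Y = M\<^sub>B W\<^sub>D\<close>, where \<open>Z\<close> and
  \<open>T Y / g\<close> have no poles in \<open>\<Omega>\<close>, and the two summands are removed by a row and a column operation that are regular in \<open>\<Omega>\<close>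
  (\<open>equivalence_identity\<close>, \<open>transfer_equivalence\<close>). The size of the added identity block is the
  number of rows of \<open>K\<^sub>D\<close>.
\<close>

section \<open>Full rank of matrices over a field\<close>

text \<open>
  Row reduction gives an invertible \<open>P\<close> with \<open>P * G\<close> in reduced echelon form. A row without a
  pivot vanishes, and then the corresponding row of \<open>P\<close> is a nonzero vector in the left kernel of
  \<open>G\<close>. So every row has a pivot, and selecting the pivot columns inverts \<open>P * G\<close> from the right.
\<close>

lemma right_inverse_if_rows_independent:
  fixes G :: "'a::field mat"
  assumes G: "G \<in> carrier_mat k l"
    and inj: "\<And>c. c \<in> carrier_vec k \<Longrightarrow> G\<^sup>T *\<^sub>v c = 0\<^sub>v l \<Longrightarrow> c = 0\<^sub>v k"
  shows "\<exists>V\<in>carrier_mat l k. G * V = 1\<^sub>m k"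
proof -
  define E where "E = gauss_jordan_single G"
  note gj = gauss_jordan_single[OF G E_def[symmetric]]
  have E: "E \<in> carrier_mat k l" by (rule gj(2))
  obtain P Q where EP: "E = P * G" and P: "P \<in> carrier_mat k k" and Q: "Q \<in> carrier_mat k k"
    and PQ: "P * Q = 1\<^sub>m k" and QP: "Q * P = 1\<^sub>m k" using gj(4) by auto
  obtain f where f: "pivot_fun E f l" using gj(3) E unfolding row_echelon_form_def by auto
  have dimE: "dim_row E = k" using E by simp
  note piv = pivot_funD[OF dimE f]
  have pivot: "f i < l" if i: "i < k" for i
  proof (rule ccontr)
    assume "\<not> f i < l"
    with piv(1)[OF i] have fi: "f i = l" by simp
    define c where "c = row P i"
    have c: "c \<in> carrier_vec k" using P i by (simp add: c_def)
    have "G\<^sup>T *\<^sub>v c = row E i"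
      using G P i by (intro eq_vecI) (auto simp: EP c_def intro: comm_scalar_prod[of _ k])
    also have "\<dots> = 0\<^sub>v l" using piv(2)[OF i] E i fi by (intro eq_vecI) auto
    finally have "c = 0\<^sub>v k" by (rule inj[OF c])
    moreover have "c \<bullet> col Q i = 1"
      using arg_cong[OF PQ, of "\<lambda>M. M $$ (i, i)"] P Q i by (simp add: c_def)
    moreover have "0\<^sub>v k \<bullet> col Q i = 0" using Q i by (intro scalar_prod_left_zero) auto
    ultimately show False by simp
  qed
  define V where "V = mat l k (\<lambda>(j, i). if j = f i then 1 else (0::'a))"
  have V: "V \<in> carrier_mat l k" by (simp add: V_def)
  have EV: "E * V = 1\<^sub>m k"
  proof (rule eq_matI)
    fix i j assume "i < dim_row (1\<^sub>m k :: 'a mat)" "j < dim_col (1\<^sub>m k :: 'a mat)"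
    hence i: "i < k" and j: "j < k" by auto
    have "(E * V) $$ (i, j) = (\<Sum>t<l. E $$ (i, t) * (if t = f j then 1 else 0))"
      using E i j by (auto simp: V_def scalar_prod_def atLeast0LessThan intro!: sum.cong)
    also have "\<dots> = (\<Sum>t<l. if t = f j then E $$ (i, t) else 0)"
      by (intro sum.cong) auto
    also have "\<dots> = E $$ (i, f j)" using pivot[OF j] by simp
    also have "\<dots> = 1\<^sub>m k $$ (i, j)" using piv(4,5)[OF j pivot[OF j]] i j by auto
    finally show "(E * V) $$ (i, j) = 1\<^sub>m k $$ (i, j)" .
  qed (use E V in auto)
  have "G = Q * E" using assoc_mult_mat[OF Q P G] QP G by (simp add: EP)
  hence "G * (V * P) = Q * (E * V) * P"
    using Q E V P by (simp add: assoc_mult_mat[of _ k l _ k _ k] assoc_mult_mat[of _ k k _ l _ k]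
      assoc_mult_mat[of _ k k _ k _ k])
  also have "\<dots> = 1\<^sub>m k" using Q P QP by (simp add: EV)
  finally have "G * (V * P) = 1\<^sub>m k" .
  thus ?thesis using V P by (intro bexI[of _ "V * P"]) auto
qed

lemma (in vec_space) maximal_independent_columns:
  "\<exists>S. maximal S (\<lambda>T. T \<subseteq> set (cols A) \<and> lin_indpt T)"
proof -
  have "lin_indpt {}" by (rule finite_lin_indpt2) auto
  thus ?thesis
    using maximal_exists_superset[of "set (cols A)" "\<lambda>T. T \<subseteq> set (cols A) \<and> lin_indpt T" "{}"]
    by auto
qed

lemma (in vec_space) rank_le_dim:
  assumes A: "A \<in> carrier_mat n nc" shows "rank A \<le> n"
proof -
  from maximal_independent_columns obtain S
    where S: "maximal S (\<lambda>T. T \<subseteq> set (cols A) \<and> lin_indpt T)" by blast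
  hence "S \<subseteq> set (cols A)" and li: "lin_indpt S" unfolding maximal_def by auto
  hence "S \<subseteq> carrier_vec n" using A cols_dim[of A] by auto
  hence "card S \<le> n" using li_le_dim(2)[OF fin_dim _ li] dim_is_n by auto
  thus ?thesis using rank_card_indpt[OF A S] by simp
qed

text \<open>
  A maximal independent set of columns has \<open>n\<close> elements and therefore spans the whole space, so
  every unit vector is a combination of columns.
\<close>

lemma (in vec_space) right_inverse_if_full_rank:
  assumes A: "A \<in> carrier_mat n nc" and r: "n \<le> rank A"
  shows "\<exists>X\<in>carrier_mat nc n. A * X = 1\<^sub>m n"
proof -
  from maximal_independent_columns obtain S
    where S: "maximal S (\<lambda>T. T \<subseteq> set (cols A) \<and> lin_indpt T)" by blast
  have Sc: "S \<subseteq> set (cols A)" and li: "lin_indpt S" using S unfolding maximal_def by blast+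
  have cA: "set (cols A) \<subseteq> carrier_vec n" using A cols_dim by blast
  have "basis S"
    using dim_li_is_basis[of S] Sc cA li r rank_card_indpt[OF A S] dim_is_n
    by (auto dest: finite_subset)
  hence "span S = carrier_vec n" unfolding basis_def by simp
  hence "carrier_vec n \<subseteq> col_space A"
    using span_is_monotone[OF Sc] unfolding col_space_def by auto
  hence "\<exists>x\<in>carrier_vec nc. A *\<^sub>v x = y" if "y \<in> carrier_vec n" for y
    using col_space_eq[OF A] A that by auto
  then obtain g where g: "\<And>y. y \<in> carrier_vec n \<Longrightarrow> g y \<in> carrier_vec nc \<and> A *\<^sub>v g y = y"
    by metis
  define X where "X = mat_of_cols nc (map (\<lambda>i. g (unit_vec n i)) [0..<n])"
  have X: "X \<in> carrier_mat nc n"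
    using mat_of_cols_carrier(1)[of nc "map (\<lambda>i. g (unit_vec n i)) [0..<n]"] by (simp add: X_def)
  have "A * X = 1\<^sub>m n"
  proof (rule mat_col_eqI)
    fix i assume "i < dim_col (1\<^sub>m n :: 'a mat)"
    hence i: "i < n" by simp
    have "col (A * X) i = A *\<^sub>v col X i" by (rule col_mult2[OF A X i])
    also have "col X i = g (unit_vec n i)" using g i by (simp add: X_def)
    finally show "col (A * X) i = col (1\<^sub>m n) i" using g i by simp
  qed (use A X in auto)
  thus ?thesis using X by auto
qed

lemma (in vec_space) full_rank_if_right_inverse:
  assumes A: "A \<in> carrier_mat n nc" and X: "X \<in> carrier_mat nc n" and AV: "A * X = 1\<^sub>m n"
  shows "rank A = n"
proof -
  have "y \<in> col_space A" if y: "y \<in> carrier_vec n" for y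
  proof -
    have "A *\<^sub>v (X *\<^sub>v y) = y" using assoc_mult_mat_vec[OF A X y] AV y by simp
    thus ?thesis using col_space_eq[OF A] A X y by auto
  qed
  moreover have "span (set (cols A)) \<subseteq> carrier_vec n"
    using A cols_dim by (metis carrier_matD(1) span_is_subset2 module_vec_simps(3))
  ultimately have "span (set (cols A)) = carrier_vec n" unfolding col_space_def by auto
  moreover have "vs (carrier_vec n) = V" by (simp add: module_vec_def)
  ultimately show ?thesis unfolding rank_def using dim_is_n by metis
qed

lemma (in vec_space) kernel_trivial_if_full_rank:
  assumes A: "A \<in> carrier_mat n nc" and r: "nc \<le> rank A"
    and v: "v \<in> carrier_vec nc" and z: "A *\<^sub>v v = 0\<^sub>v n"
  shows "v = 0\<^sub>v nc"
proof -
  have rk: "rank A = nc" using r rank_le_nc[OF A] by simp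
  from maximal_independent_columns obtain S
    where S: "maximal S (\<lambda>T. T \<subseteq> set (cols A) \<and> lin_indpt T)" by blast
  have "card S \<le> card (set (cols A))" using S unfolding maximal_def by (simp add: card_mono)
  hence "length (cols A) \<le> card (set (cols A))" using rank_card_indpt[OF A S] rk A by simp
  hence d: "distinct (cols A)" by (metis card_distinct card_length le_antisym)
  show ?thesis using lin_depI[OF A v _ z d] full_rank_lin_indpt[OF A rk d] by blast
qed

lemma (in vec_space) columns_independent_if_kernel_trivial:
  assumes A: "A \<in> carrier_mat n nc"
    and inj: "\<And>v. v \<in> carrier_vec nc \<Longrightarrow> A *\<^sub>v v = 0\<^sub>v n \<Longrightarrow> v = 0\<^sub>v nc"
  shows "distinct (cols A)" "lin_indpt (set (cols A))"
proof -
  show d: "distinct (cols A)"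
  proof (rule ccontr)
    assume "\<not> distinct (cols A)"
    then obtain i j where ij: "i < nc" "j < nc" "i \<noteq> j" "col A i = col A j"
      using A by (auto simp: distinct_conv_nth)
    have "A *\<^sub>v unit_vec nc t = col A t" if "t < nc" for t
      using A that by (intro eq_vecI) auto
    hence "A *\<^sub>v (unit_vec nc i - unit_vec nc j) = col A i - col A j"
      using A ij by (simp add: mult_minus_distrib_mat_vec[of _ n nc])
    also have "\<dots> = 0\<^sub>v n" using A ij by (auto intro!: eq_vecI)
    finally have "unit_vec nc i - unit_vec nc j = (0\<^sub>v nc :: 'a vec)" by (intro inj) auto
    from arg_cong[OF this, of "\<lambda>v. v $ i"] show False using ij by simp
  qed
  show "lin_indpt (set (cols A))" using lin_depE[OF A _ d] inj by metis
qed

lemma surjective_if_det_nonzero: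
  fixes U :: "'a::field mat"
  assumes U: "U \<in> carrier_mat k k" and d: "det U \<noteq> 0" and y: "y \<in> carrier_vec k"
  shows "\<exists>z\<in>carrier_vec k. U *\<^sub>v z = y"
proof -
  have "(1 / det U) \<cdot>\<^sub>v (adj_mat U *\<^sub>v y) \<in> carrier_vec k" using adj_mat(1)[OF U] y by auto
  moreover have "U *\<^sub>v ((1 / det U) \<cdot>\<^sub>v (adj_mat U *\<^sub>v y)) = (1 / det U) \<cdot>\<^sub>v (U *\<^sub>v (adj_mat U *\<^sub>v y))"
    using adj_mat(1)[OF U] y U by (intro mult_mat_vec) auto
  moreover have "U *\<^sub>v (adj_mat U *\<^sub>v y) = (det U \<cdot>\<^sub>m 1\<^sub>m k) *\<^sub>v y"
    using assoc_mult_mat_vec[OF U adj_mat(1)[OF U] y] adj_mat(2)[OF U] by simp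
  moreover have "(det U \<cdot>\<^sub>m 1\<^sub>m k) *\<^sub>v y = det U \<cdot>\<^sub>v y"
    using y by (intro eq_vecI) auto
  ultimately show ?thesis using d y by (metis smult_smult_assoc nonzero_eq_divide_eq one_smult_vec)
qed

lemma mat_inverse_det_nonzero:
  fixes A :: "'a::field mat"
  assumes A: "A \<in> carrier_mat n n" and d: "det A \<noteq> 0"
  shows "the (mat_inverse A) \<in> carrier_mat n n" "A * the (mat_inverse A) = 1\<^sub>m n"
    "the (mat_inverse A) * A = 1\<^sub>m n"
proof -
  obtain X where "mat_inverse A = Some X"
    using mat_inverse(1)[OF A, of undefined] det_non_zero_imp_unit[OF A d, of undefined]
    by (cases "mat_inverse A") auto
  with mat_inverse(2)[OF A] show "the (mat_inverse A) \<in> carrier_mat n n"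
    "A * the (mat_inverse A) = 1\<^sub>m n" "the (mat_inverse A) * A = 1\<^sub>m n" by auto
qed

section \<open>Block matrices\<close>

text \<open>
  Stacked and juxtaposed matrices are block matrices with empty blocks. The following rules keep
  those empty blocks out of the later computations.
\<close>

lemma append_rows_mult:
  fixes A :: "'a::comm_ring_1 mat"
  assumes A: "A \<in> carrier_mat k1 l" and B: "B \<in> carrier_mat k2 l" and X: "X \<in> carrier_mat l q"
  shows "(A @\<^sub>r B) * X = (A * X) @\<^sub>r (B * X)"
proof (rule mat_col_eqI)
  fix j assume "j < dim_col ((A * X) @\<^sub>r (B * X))"
  hence j: "j < q" using X by (simp add: append_rows_def)
  have AB: "A @\<^sub>r B \<in> carrier_mat (k1 + k2) l" using A B by simp
  have "col ((A @\<^sub>r B) * X) j = (A @\<^sub>r B) *\<^sub>v col X j" by (rule col_mult2[OF AB X j])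
  also have "\<dots> = col (A * X) j @\<^sub>v col (B * X) j"
    unfolding col_mult2[OF A X j] col_mult2[OF B X j] using X j by (intro mat_mult_append[OF A B]) auto
  also have "\<dots> = col ((A * X) @\<^sub>r (B * X)) j"
    unfolding append_rows_def using A B X j by (subst col_four_block_mat(1)) auto
  finally show "col ((A @\<^sub>r B) * X) j = col ((A * X) @\<^sub>r (B * X)) j" .
qed (use A B X in \<open>auto simp: append_rows_def\<close>)

lemma four_block_mult_append_rows:
  fixes A :: "'a::comm_ring_1 mat"
  assumes A: "A \<in> carrier_mat k1 l1" and B: "B \<in> carrier_mat k1 l2"
    and C: "C \<in> carrier_mat k2 l1" and D: "D \<in> carrier_mat k2 l2"
    and X: "X \<in> carrier_mat l1 q" and Y: "Y \<in> carrier_mat l2 q"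
  shows "four_block_mat A B C D * (X @\<^sub>r Y) = (A * X + B * Y) @\<^sub>r (C * X + D * Y)"
proof -
  have "A * 0\<^sub>m l1 0 + B * 0\<^sub>m l2 0 = 0\<^sub>m k1 0" "C * 0\<^sub>m l1 0 + D * 0\<^sub>m l2 0 = 0\<^sub>m k2 0"
    using A B C D by (auto intro!: eq_matI)
  moreover have "X @\<^sub>r Y = four_block_mat X (0\<^sub>m l1 0) Y (0\<^sub>m l2 0)"
    using X Y by (simp add: append_rows_def)
  moreover have "(A * X + B * Y) @\<^sub>r (C * X + D * Y) =
      four_block_mat (A * X + B * Y) (0\<^sub>m k1 0) (C * X + D * Y) (0\<^sub>m k2 0)"
    using B D by (simp add: append_rows_def)
  ultimately show ?thesis
    by (simp only: mult_four_block_mat[OF A B C D X zero_carrier_mat Y zero_carrier_mat])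
qed

lemma append_cols_mult_append_rows:
  fixes A :: "'a::comm_ring_1 mat"
  assumes A: "A \<in> carrier_mat k l1" and B: "B \<in> carrier_mat k l2"
    and X: "X \<in> carrier_mat l1 q" and Y: "Y \<in> carrier_mat l2 q"
  shows "(A @\<^sub>c B) * (X @\<^sub>r Y) = A * X + B * Y"
proof -
  have "(A @\<^sub>c B) * (X @\<^sub>r Y) = (A * X + B * Y) @\<^sub>r (0\<^sub>m 0 l1 * X + 0\<^sub>m 0 l2 * Y)"
    using four_block_mult_append_rows[OF A B zero_carrier_mat[of 0 l1] zero_carrier_mat[of 0 l2] X Y] A B
    by (simp add: append_cols_def)
  also have "\<dots> = A * X + B * Y" using A B X Y by (intro eq_matI) (auto simp: append_rows_def)
  finally show ?thesis .
qed

lemma append_rows_mult_append_cols: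
  fixes A :: "'a::comm_ring_1 mat"
  assumes A: "A \<in> carrier_mat k1 l" and B: "B \<in> carrier_mat k2 l"
    and X: "X \<in> carrier_mat l q1" and Y: "Y \<in> carrier_mat l q2"
  shows "(A @\<^sub>r B) * (X @\<^sub>c Y) = four_block_mat (A * X) (A * Y) (B * X) (B * Y)"
proof -
  have "A @\<^sub>r B = four_block_mat A (0\<^sub>m k1 0) B (0\<^sub>m k2 0)"
    and "X @\<^sub>c Y = four_block_mat X Y (0\<^sub>m 0 q1) (0\<^sub>m 0 q2)"
    using A B X Y by (simp_all add: append_rows_def append_cols_def)
  moreover have "A * X + 0\<^sub>m k1 0 * 0\<^sub>m 0 q1 = A * X" "A * Y + 0\<^sub>m k1 0 * 0\<^sub>m 0 q2 = A * Y"
    "B * X + 0\<^sub>m k2 0 * 0\<^sub>m 0 q1 = B * X" "B * Y + 0\<^sub>m k2 0 * 0\<^sub>m 0 q2 = B * Y"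
    using A B X Y by auto
  ultimately show ?thesis
    by (simp only: mult_four_block_mat[OF A zero_carrier_mat B zero_carrier_mat X Y zero_carrier_mat zero_carrier_mat])
qed

lemma append_rows_add:
  fixes A :: "'a::comm_ring_1 mat"
  assumes "A \<in> carrier_mat k1 l" "B \<in> carrier_mat k2 l" "C \<in> carrier_mat k1 l" "D \<in> carrier_mat k2 l"
  shows "(A @\<^sub>r B) + (C @\<^sub>r D) = (A + C) @\<^sub>r (B + D)"
  using assms by (intro eq_matI) (auto simp: append_rows_def)

lemma map_append_rows:
  assumes "A \<in> carrier_mat k1 l" "B \<in> carrier_mat k2 l"
  shows "map_mat f (A @\<^sub>r B) = map_mat f A @\<^sub>r map_mat f B"
  using assms by (intro eq_matI) (auto simp: append_rows_def)

lemma append_cols_carrier [simp]: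
  assumes "A \<in> carrier_mat k l1" "B \<in> carrier_mat k l2"
  shows "A @\<^sub>c B \<in> carrier_mat k (l1 + l2)"
  using assms by (auto simp: append_cols_def)

lemma append_rows_split:
  assumes W: "W \<in> carrier_mat (k1 + k2) l"
  obtains X Y where "X \<in> carrier_mat k1 l" "Y \<in> carrier_mat k2 l" "W = X @\<^sub>r Y"
proof
  show "W = mat k1 l (\<lambda>(i, j). W $$ (i, j)) @\<^sub>r mat k2 l (\<lambda>(i, j). W $$ (k1 + i, j))"
    using W by (intro eq_matI) (auto simp: append_rows_def)
qed auto

lemma append_vec_zero_iff:
  assumes "v \<in> carrier_vec n" "w \<in> carrier_vec k"
  shows "v @\<^sub>v w = 0\<^sub>v (n + k) \<longleftrightarrow> v = 0\<^sub>v n \<and> w = 0\<^sub>v k"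
proof -
  have "0\<^sub>v (n + k) = 0\<^sub>v n @\<^sub>v 0\<^sub>v k" by (intro eq_vecI) auto
  thus ?thesis unfolding \<open>0\<^sub>v (n + k) = 0\<^sub>v n @\<^sub>v 0\<^sub>v k\<close> by (intro append_vec_eq[OF assms(1)]) simp
qed

lemma det_smult_one: "det (g \<cdot>\<^sub>m 1\<^sub>m k) = (g :: 'a::comm_ring_1) ^ k"
  by (simp add: det_smult)

lemma mat_sum_rearrange:
  fixes a :: "'a::comm_ring_1 mat"
  assumes "a \<in> carrier_mat p l" "b \<in> carrier_mat p l" "c \<in> carrier_mat p l" "d \<in> carrier_mat p l"
    "e \<in> carrier_mat p l" "f \<in> carrier_mat p l"
  shows "(a + b) + (c + d) + (e + f - c) = (a + e) + (b + (f + d))"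
  using assms by (intro eq_matI) (auto simp: algebra_simps)

lemma linear_poly_mat_four_block:
  assumes "A \<in> carrier_mat k1 l1" "B \<in> carrier_mat k1 l2" "C \<in> carrier_mat k2 l1" "D \<in> carrier_mat k2 l2"
    and "linear_poly_mat A" "linear_poly_mat B" "linear_poly_mat C" "linear_poly_mat D"
  shows "linear_poly_mat (four_block_mat A B C D)"
  using assms unfolding linear_poly_mat_def by auto

lemma linear_poly_mat_append_rows_zero:
  assumes "A \<in> carrier_mat k1 l" "linear_poly_mat A"
  shows "linear_poly_mat (A @\<^sub>r 0\<^sub>m k2 l)"
  unfolding append_rows_def using assms unfolding linear_poly_mat_def by auto

section \<open>Values of minimal bases\<close>

text \<open>
  The matrix form of being a basis: the map from coefficient vectors to combinations of the rows
  is injective (which covers both the absence of repetitions and independence) with image \<open>V\<close>.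
  In this form a change of basis is a matrix multiplication.
\<close>

lemma polynomial_basis_rows_iff:
  fixes K :: "'a::field poly mat"
  assumes K: "K \<in> carrier_mat k l"
  shows "polynomial_basis l V (rows K) \<longleftrightarrow>
    (\<forall>z\<in>carrier_vec k. (rat_mat K)\<^sup>T *\<^sub>v z = 0\<^sub>v l \<longrightarrow> z = 0\<^sub>v k) \<and>
    V = {y. \<exists>z\<in>carrier_vec k. (rat_mat K)\<^sup>T *\<^sub>v z = y}"
proof -
  interpret vec_space "TYPE('a poly fract)" l .
  let ?B = "(rat_mat K)\<^sup>T"
  have B: "?B \<in> carrier_mat l k" using K by simp
  have cols: "cols ?B = map rat_vec (rows K)"
    using K by (intro nth_equalityI) (auto intro!: eq_vecI)
  have inj: "inj_on (rat_vec :: 'a poly vec \<Rightarrow> _) X" for X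
    by (rule inj_onI) (metis index_map_vec(1,2) to_fract_eq_iff eq_vecI)
  have dist: "distinct (cols ?B) \<longleftrightarrow> distinct (rows K)"
    unfolding cols distinct_map using inj by simp
  have set: "set (cols ?B) = rat_vec ` set (rows K)" unfolding cols by simp
  have carr: "set (rows K) \<subseteq> carrier_vec l" using rows_carrier[of K] K by auto
  have span: "span (set (cols ?B)) = {y. \<exists>z\<in>carrier_vec k. ?B *\<^sub>v z = y}"
    using col_space_eq[OF B] B unfolding col_space_def by auto
  have ker: "(\<forall>z\<in>carrier_vec k. ?B *\<^sub>v z = 0\<^sub>v l \<longrightarrow> z = 0\<^sub>v k) \<longleftrightarrow>
      distinct (cols ?B) \<and> lin_indpt (set (cols ?B))"
    using columns_independent_if_kernel_trivial[OF B] lin_depI[OF B] by blast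
  show ?thesis
    unfolding ker span[symmetric] unfolding polynomial_basis_def using carr dist set by auto
qed

text \<open>
  The coefficient map of \<open>K'\<close> is that of \<open>K\<close> preceded by the bijection \<open>U\<^sup>T\<close>.
\<close>

lemma polynomial_basis_rows_transform:
  fixes K :: "'a::field poly mat"
  assumes K: "K \<in> carrier_mat k l" and K': "K' \<in> carrier_mat k l" and U: "U \<in> carrier_mat k k"
    and d: "det U \<noteq> 0" and UK: "rat_mat K' = U * rat_mat K"
    and pb: "polynomial_basis l V (rows K)"
  shows "polynomial_basis l V (rows K')"
proof -
  have Ut: "U\<^sup>T \<in> carrier_mat k k" using U by simp
  have dt: "det (U\<^sup>T) \<noteq> 0" using det_transpose[OF U] d by simp
  have Kt: "(rat_mat K)\<^sup>T \<in> carrier_mat l k" using K by simp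
  have "(rat_mat K')\<^sup>T = (rat_mat K)\<^sup>T * U\<^sup>T"
    unfolding UK using U K by (intro transpose_mult) auto
  hence eq: "(rat_mat K')\<^sup>T *\<^sub>v z = (rat_mat K)\<^sup>T *\<^sub>v (U\<^sup>T *\<^sub>v z)" if "z \<in> carrier_vec k" for z
    using assoc_mult_mat_vec[OF Kt Ut that] by simp
  note ker = det_0_iff_vec_prod_zero_field[OF Ut]
  show ?thesis unfolding polynomial_basis_rows_iff[OF K']
  proof (intro conjI ballI impI)
    fix z assume z: "z \<in> carrier_vec k" and "(rat_mat K')\<^sup>T *\<^sub>v z = 0\<^sub>v l"
    hence "U\<^sup>T *\<^sub>v z = 0\<^sub>v k"
      using pb eq[OF z] mult_mat_vec_carrier[OF Ut z] unfolding polynomial_basis_rows_iff[OF K] by auto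
    thus "z = 0\<^sub>v k" using ker dt z by auto
  next
    have "{y. \<exists>z\<in>carrier_vec k. (rat_mat K)\<^sup>T *\<^sub>v z = y} = {y. \<exists>z\<in>carrier_vec k. (rat_mat K')\<^sup>T *\<^sub>v z = y}"
      using eq surjective_if_det_nonzero[OF Ut dt] mult_mat_vec_carrier[OF Ut] by (auto; metis)
    thus "V = {y. \<exists>z\<in>carrier_vec k. (rat_mat K')\<^sup>T *\<^sub>v z = y}"
      using pb unfolding polynomial_basis_rows_iff[OF K] by simp
  qed
qed

lemma vec_degree_le_iff:
  "vec_degree v \<le> d \<longleftrightarrow> (\<forall>i<dim_vec v. degree (v $ i) \<le> d)"
  unfolding vec_degree_def vec_set_def by auto

lemma vec_degree_less_iff:
  "vec_degree v < d \<longleftrightarrow> 0 < d \<and> (\<forall>i<dim_vec v. degree (v $ i) < d)"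
  unfolding vec_degree_def vec_set_def by auto

text \<open>
  Forney's argument. If the values of the rows at \<open>x\<close> satisfied a nontrivial relation with
  coefficients \<open>c\<close>, then the combination of the polynomial rows with these constants would be
  divisible by \<open>X - x\<close>. Replace a row of largest degree among those with \<open>c\<^sub>j \<noteq> 0\<close> by the quotient.
  The replaced row occurs in the relation, so the span and the independence survive, but the
  degree sum drops, against minimality.
\<close>

lemma minimal_basis_rows_independent_at:
  fixes K :: "'a::field poly mat"
  assumes mb: "minimal_basis K" and K: "K \<in> carrier_mat k l"
    and c: "c \<in> carrier_vec k" and z: "(map_mat (\<lambda>q. poly q x) K)\<^sup>T *\<^sub>v c = 0\<^sub>v l"
  shows "c = 0\<^sub>v k"
proof (rule ccontr)
  assume c0: "c \<noteq> 0\<^sub>v k"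
  define J where "J = {j. j < k \<and> c $ j \<noteq> 0}"
  define d where "d j = vec_degree (row K j)" for j
  have J: "finite J" "J \<noteq> {}" using c0 c by (auto simp: J_def vec_eq_iff)
  \<comment> \<open>Row \<open>i\<close> has the largest degree among the rows that occur in the relation.\<close>
  have "Max (d ` J) \<in> d ` J" using J by (intro Max_in) auto
  then obtain i where iJ: "i \<in> J" and di: "d i = Max (d ` J)" by auto
  have dmax: "d j \<le> d i" if "j \<in> J" for j using J that by (simp add: di)
  have i: "i < k" and ci: "c $ i \<noteq> 0" using iJ by (auto simp: J_def)
  define u where "u b = (\<Sum>j<k. [:c $ j:] * K $$ (j, b))" for b
  define q where "q b = u b div [:-x, 1:]" for b
  have ux: "poly (u b) x = 0" if b: "b < l" for b
    using arg_cong[OF z, of "\<lambda>v. v $ b"] b K c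
    by (simp add: u_def poly_sum scalar_prod_def atLeast0LessThan mult.commute)
  have uq: "u b = [:-x, 1:] * q b" if "b < l" for b
    using ux[OF that] unfolding q_def poly_eq_0_iff_dvd by (simp only: dvd_mult_div_cancel)
  have du: "degree (u b) \<le> d i" if b: "b < l" for b
    unfolding u_def
  proof (rule degree_sum_le)
    fix j assume "j \<in> {..<k}"
    hence j: "j < k" by simp
    show "degree ([:c $ j:] * K $$ (j, b)) \<le> d i"
    proof (cases "c $ j = 0")
      case False
      have "degree (K $$ (j, b)) \<le> d j"
        using vec_degree_le_iff[of "row K j" "d j"] j b K by (auto simp: d_def)
      also have "\<dots> \<le> d i" using j False by (intro dmax) (simp add: J_def)
      finally show ?thesis using False by (simp)
    qed simp
  qed simp
  \<comment> \<open>Row \<open>i\<close> is replaced by the quotient \<open>q\<close> of the relation by \<open>X - x\<close>.\<close>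
  define K' where "K' = mat k l (\<lambda>(a, b). if a = i then q b else K $$ (a, b))"
  have K': "K' \<in> carrier_mat k l" by (simp add: K'_def)
  define r where "r = to_fract [:-x, 1:]"
  have r: "r \<noteq> 0" by (simp add: r_def)
  \<comment> \<open>The row operation that leads from \<open>K\<close> to \<open>K'\<close>; it is invertible because \<open>c\<^sub>i \<noteq> 0\<close>.\<close>
  define U where "U = mat k k (\<lambda>(a, b). if a = i then to_fract [:c $ b:] / r else if a = b then 1 else 0)"
  have U: "U \<in> carrier_mat k k" by (simp add: U_def)
  have dU: "det U \<noteq> 0"
  proof
    assume "det U = 0"
    hence "det (U\<^sup>T) = 0" using det_transpose[OF U] by simp
    then obtain v where v: "v \<in> carrier_vec k" "v \<noteq> 0\<^sub>v k" "U\<^sup>T *\<^sub>v v = 0\<^sub>v k"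
      using det_0_iff_vec_prod_zero_field[of "U\<^sup>T" k] U by auto
    have Uv: "(if b = i then 0 else v $ b) + to_fract [:c $ b:] / r * v $ i = 0" if b: "b < k" for b
    proof -
      have "0 = (U\<^sup>T *\<^sub>v v) $ b" using v b by simp
      also have "\<dots> = (\<Sum>a<k. U $$ (a, b) * v $ a)"
        using b U v(1) by (simp add: scalar_prod_def atLeast0LessThan)
      also have "\<dots> = (\<Sum>a<k. (if a = b then (if b = i then 0 else v $ b) else 0)
          + (if a = i then to_fract [:c $ b:] / r * v $ i else 0))"
        using b by (intro sum.cong) (auto simp: U_def)
      also have "\<dots> = (if b = i then 0 else v $ b) + to_fract [:c $ b:] / r * v $ i"
        using b i by (simp add: sum.distrib)
      finally show ?thesis by simp
    qed
    have vi: "v $ i = 0" using Uv[OF i] ci r by simp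
    have "v $ b = 0" if "b < k" for b using Uv[OF that] vi by (cases "b = i") auto
    with v show False by (auto simp: vec_eq_iff)
  qed
  have UK: "rat_mat K' = U * rat_mat K"
  proof (rule eq_matI)
    fix a b assume "a < dim_row (U * rat_mat K)" "b < dim_col (U * rat_mat K)"
    hence a: "a < k" and b: "b < l" using U K by auto
    have "(U * rat_mat K) $$ (a, b) = (\<Sum>j<k. U $$ (a, j) * to_fract (K $$ (j, b)))"
      using a b U K by (simp add: scalar_prod_def atLeast0LessThan)
    also have "\<dots> = to_fract (K' $$ (a, b))"
    proof (cases "a = i")
      case True
      have "(\<Sum>j<k. U $$ (a, j) * to_fract (K $$ (j, b))) = to_fract (u b) / r"
        using a True
        by (simp add: U_def u_def sum_divide_distrib to_fract_mult[symmetric] del: to_fract_mult)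
      also have "to_fract (u b) = r * to_fract (q b)"
        unfolding r_def uq[OF b] to_fract_mult ..
      finally show ?thesis using True a b r by (simp add: K'_def)
    next
      case False
      have "(\<Sum>j<k. U $$ (a, j) * to_fract (K $$ (j, b))) =
          (\<Sum>j<k. if j = a then to_fract (K $$ (a, b)) else 0)"
        using a False by (intro sum.cong) (auto simp: U_def)
      thus ?thesis using a b False by (simp add: K'_def)
    qed
    finally show "rat_mat K' $$ (a, b) = (U * rat_mat K) $$ (a, b)" using a b K' by simp
  qed (use U K K' in auto)
  obtain V where pb: "polynomial_basis l V (rows K)"
    and min: "\<And>cs. polynomial_basis l V cs \<Longrightarrow>
      sum_list (map vec_degree (rows K)) \<le> sum_list (map vec_degree cs)"
    using mb K unfolding minimal_basis_def minimal_polynomial_basis_def by auto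
  have pb': "polynomial_basis l V (rows K')"
    by (rule polynomial_basis_rows_transform[OF K K' U dU UK pb])
  have sum: "sum_list (map vec_degree (rows G)) = (\<Sum>j<k. vec_degree (row G j))"
    if "G \<in> carrier_mat k l" for G :: "'a poly mat"
    using that by (simp add: rows_def sum_list_sum_nth atLeast0LessThan)
  \<comment> \<open>Only a nonzero quotient has smaller degree than the relation itself, so the new row must not vanish.\<close>
  have "row K' i \<noteq> 0\<^sub>v l"
  proof
    assume 0: "row K' i = 0\<^sub>v l"
    have "(rat_mat K')\<^sup>T *\<^sub>v unit_vec k i = 0\<^sub>v l"
    proof (rule eq_vecI)
      fix b assume "b < dim_vec (0\<^sub>v l :: 'a poly fract vec)"
      hence b: "b < l" by simp
      have "((rat_mat K')\<^sup>T *\<^sub>v unit_vec k i) $ b = to_fract (row K' i $ b)"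
        using b i K' by simp
      thus "((rat_mat K')\<^sup>T *\<^sub>v unit_vec k i) $ b = 0\<^sub>v l $ b" using 0 b by simp
    qed (use K' in simp)
    hence "unit_vec k i = (0\<^sub>v k :: 'a poly fract vec)"
      using pb' unfolding polynomial_basis_rows_iff[OF K'] by auto
    from arg_cong[OF this, of "\<lambda>v. v $ i"] show False using i by simp
  qed
  then obtain b where b: "b < l" and qb: "q b \<noteq> 0"
    using i K' by (auto simp: vec_eq_iff K'_def)
  have deg: "degree (q b) < d i" if "q b \<noteq> 0" "b < l" for b
    using du[OF that(2)] that(1) unfolding uq[OF that(2)] by (subst (asm) degree_mult_eq) auto
  have pos: "0 < d i" using deg[OF qb b] by simp
  have degi: "vec_degree (row K' i) < d i"
    unfolding vec_degree_less_iff
  proof (intro conjI allI impI pos)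
    fix b assume "b < dim_vec (row K' i)"
    hence b: "b < l" using K' by simp
    show "degree (row K' i $ b) < d i"
      using deg[OF _ b] pos i b by (cases "q b = 0") (auto simp: K'_def)
  qed
  have "(\<Sum>j<k. vec_degree (row K' j)) < (\<Sum>j<k. vec_degree (row K j))"
  proof (rule sum_strict_mono_ex1)
    show "\<forall>j\<in>{..<k}. vec_degree (row K' j) \<le> vec_degree (row K j)"
    proof
      fix j assume j: "j \<in> {..<k}"
      have "row K' j = row K j" if "j \<noteq> i" using j K that by (auto simp: K'_def intro!: eq_vecI)
      thus "vec_degree (row K' j) \<le> vec_degree (row K j)"
        using degi by (cases "j = i") (auto simp: d_def)
    qed
    show "\<exists>j\<in>{..<k}. vec_degree (row K' j) < vec_degree (row K j)"
      using degi i by (auto simp: d_def)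
  qed simp
  with min[OF pb'] sum[OF K] sum[OF K'] show False by simp
qed

section \<open>Right inverses of polynomial matrices and dual minimal bases\<close>

lemma eval_mat_mult:
  fixes G :: "'a::field poly mat"
  assumes "G \<in> carrier_mat k l" and "H \<in> carrier_mat l q"
  shows "map_mat (\<lambda>q. poly q x) (G * H) = map_mat (\<lambda>q. poly q x) G * map_mat (\<lambda>q. poly q x) H"
  by (rule semiring_hom.mat_hom_mult[OF poly_hom.semiring_hom_axioms assms])

lemma eval_mat_one: "map_mat (\<lambda>q. poly q x) (1\<^sub>m k) = (1\<^sub>m k :: 'a::field mat)"
  by (rule semiring_hom.mat_hom_one[OF poly_hom.semiring_hom_axioms])

lemma eval_mat_det: "det (map_mat (\<lambda>q. poly q x) (G :: 'a::field poly mat)) = poly (det G) x"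
  by (rule comm_ring_hom.hom_det[OF poly_hom.comm_ring_hom_axioms])

text \<open>
  A right inverse of the value \<open>G(x)\<close> is read as a constant polynomial matrix \<open>V'\<close>. Then \<open>G * V'\<close>
  is square with determinant \<open>1\<close> at \<open>x\<close>, and its adjugate completes \<open>V'\<close> to a right inverse up
  to this determinant.
\<close>

lemma scaled_right_inverse_at:
  fixes G :: "'a::field poly mat"
  assumes G: "G \<in> carrier_mat k l" and V: "V \<in> carrier_mat l k"
    and GV: "map_mat (\<lambda>q. poly q x) G * V = 1\<^sub>m k"
  shows "\<exists>e W. W \<in> carrier_mat l k \<and> G * W = e \<cdot>\<^sub>m 1\<^sub>m k \<and> poly e x \<noteq> 0"
proof -
  define V' where "V' = map_mat (\<lambda>c. [:c:]) V"
  have V': "V' \<in> carrier_mat l k" using V by (simp add: V'_def)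
  have eV': "map_mat (\<lambda>q. poly q x) V' = V" using V by (intro eq_matI) (auto simp: V'_def)
  define H where "H = G * V'"
  have H: "H \<in> carrier_mat k k" using G V' by (simp add: H_def)
  have "map_mat (\<lambda>q. poly q x) H = 1\<^sub>m k"
    unfolding H_def eval_mat_mult[OF G V'] eV' by (rule GV)
  hence "poly (det H) x = 1" using eval_mat_det[of x H] by simp
  moreover have "G * (V' * adj_mat H) = det H \<cdot>\<^sub>m 1\<^sub>m k"
    using assoc_mult_mat[OF G V' adj_mat(1)[OF H]] adj_mat(2)[OF H] by (simp add: H_def)
  ultimately show ?thesis using V' adj_mat(1)[OF H] by (intro exI[of _ "det H"] exI[of _ "V' * adj_mat H"]) auto
qed

text \<open>
  The polynomials \<open>g\<close> such that \<open>g\<close> times the identity is a right multiple of \<open>G\<close> form an ideal.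
  At every point of \<open>\<Omega>\<close> some element of it does not vanish, hence neither does a generator. So
  right inverses of all the values of \<open>G\<close> on \<open>\<Omega>\<close> can be replaced by one rational right inverse
  without poles in \<open>\<Omega>\<close>. The matrix \<open>W0\<close> makes sure that the ideal is not zero
  even if \<open>\<Omega>\<close> is empty.
\<close>

lemma scaled_right_inverse_on:
  fixes G :: "'a::field poly mat"
  assumes G: "G \<in> carrier_mat k l"
    and pt: "\<And>x. x \<in> \<Omega> \<Longrightarrow> \<exists>V\<in>carrier_mat l k. map_mat (\<lambda>q. poly q x) G * V = 1\<^sub>m k"
    and W0: "W0 \<in> carrier_mat l k" and GW0: "G * W0 = d0 \<cdot>\<^sub>m 1\<^sub>m k" and d0: "d0 \<noteq> 0"
  shows "\<exists>g W. W \<in> carrier_mat l k \<and> G * W = g \<cdot>\<^sub>m 1\<^sub>m k \<and> g \<noteq> 0 \<and> (\<forall>x\<in>\<Omega>. poly g x \<noteq> 0)"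
proof -
  define J where "J g \<longleftrightarrow> (\<exists>W\<in>carrier_mat l k. G * W = g \<cdot>\<^sub>m 1\<^sub>m k)" for g
  \<comment> \<open>The generator of the ideal \<open>J\<close> is found as a nonzero element of least degree.\<close>
  have "\<exists>g. (J g \<and> g \<noteq> 0) \<and> (\<forall>h. J h \<and> h \<noteq> 0 \<longrightarrow> degree g \<le> degree h)"
    using ex_has_least_nat[of "\<lambda>g. J g \<and> g \<noteq> 0" d0 degree] W0 GW0 d0 unfolding J_def by auto
  then obtain g where g: "J g" "g \<noteq> 0" and least: "\<And>h. J h \<Longrightarrow> h \<noteq> 0 \<Longrightarrow> degree g \<le> degree h"
    by blast
  obtain W where W: "W \<in> carrier_mat l k" and GW: "G * W = g \<cdot>\<^sub>m 1\<^sub>m k" using g by (auto simp: J_def)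
  have "poly g x \<noteq> 0" if x: "x \<in> \<Omega>" for x
  proof
    assume gx: "poly g x = 0"
    obtain V where V: "V \<in> carrier_mat l k" "map_mat (\<lambda>q. poly q x) G * V = 1\<^sub>m k"
      using pt[OF x] by (elim bexE)
    obtain e W' where W': "W' \<in> carrier_mat l k" and GW': "G * W' = e \<cdot>\<^sub>m 1\<^sub>m k"
      and ex: "poly e x \<noteq> 0" using scaled_right_inverse_at[OF G V] by blast
    have "G * (W' + (- (e div g)) \<cdot>\<^sub>m W) = G * W' + (- (e div g)) \<cdot>\<^sub>m (G * W)"
      using G W W' by (subst mult_add_distrib_mat[of _ k l _ k]) (auto simp: mult_smult_distrib)
    also have "\<dots> = (e mod g) \<cdot>\<^sub>m 1\<^sub>m k"
      unfolding GW GW'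
      by (intro eq_matI) (auto simp: minus_mult_div_eq_mod[symmetric] algebra_simps)
    finally have "J (e mod g)" unfolding J_def by (rule bexI) (simp add: W W')
    moreover have "poly (e mod g) x = poly e x"
      using gx by (simp add: minus_mult_div_eq_mod[symmetric])
    hence "e mod g \<noteq> 0" using ex by auto
    ultimately show False using least[of "e mod g"] degree_mod_less[OF g(2), of e] by auto
  qed
  thus ?thesis using W GW g(2) by auto
qed

text \<open>
  A denominator without any zero in an algebraically closed field is constant.
\<close>

lemma minimal_basis_right_inverse:
  fixes K :: "'a::alg_closed_field poly mat"
  assumes mb: "minimal_basis K" and K: "K \<in> carrier_mat k l"
  shows "\<exists>W\<in>carrier_mat l k. K * W = 1\<^sub>m k"
proof -
  have pt: "\<exists>V\<in>carrier_mat l k. map_mat (\<lambda>q. poly q x) K * V = 1\<^sub>m k" for x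
    using minimal_basis_rows_independent_at[OF mb K] K
    by (intro right_inverse_if_rows_independent) auto
  from pt[of 0] obtain V where V: "V \<in> carrier_mat l k" "map_mat (\<lambda>q. poly q 0) K * V = 1\<^sub>m k"
    by (elim bexE)
  obtain e W0 where W0: "W0 \<in> carrier_mat l k" "K * W0 = e \<cdot>\<^sub>m 1\<^sub>m k" and "poly e 0 \<noteq> 0"
    using scaled_right_inverse_at[OF K V] by blast
  hence "e \<noteq> 0" by auto
  with scaled_right_inverse_on[where \<Omega> = UNIV, OF K pt W0] obtain g W where W: "W \<in> carrier_mat l k" and KW: "K * W = g \<cdot>\<^sub>m 1\<^sub>m k"
    and g: "g \<noteq> 0" and root: "\<And>x. poly g x \<noteq> 0"
    by blast
  have "degree g = 0" using alg_closed_imp_poly_has_root[of g] root by auto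
  then obtain a where a: "g = [:a:]" by (rule degree_eq_zeroE)
  with g have "a \<noteq> 0" by simp
  hence "K * ([:1 / a:] \<cdot>\<^sub>m W) = 1\<^sub>m k"
    using mult_smult_distrib[OF K W] by (auto simp: KW a one_pCons intro!: eq_matI)
  thus ?thesis using W by (intro bexI[of _ "[:1 / a:] \<cdot>\<^sub>m W"]) auto
qed

lemma poly_mat_left_right_inverse:
  fixes G :: "'a::field poly mat"
  assumes G: "G \<in> carrier_mat n n" and H: "H \<in> carrier_mat n n" and GH: "G * H = 1\<^sub>m n"
  shows "H * G = 1\<^sub>m n"
proof -
  have "rat_mat G * rat_mat H = 1\<^sub>m n"
    unfolding to_fract_hom.mat_hom_mult[OF G H, symmetric] GH by (rule to_fract_hom.mat_hom_one)
  hence "rat_mat H * rat_mat G = 1\<^sub>m n"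
    using mat_mult_left_right_inverse[of "rat_mat G" n "rat_mat H"] G H by simp
  hence "rat_mat (H * G) = rat_mat (1\<^sub>m n)"
    unfolding to_fract_hom.mat_hom_mult[OF H G] to_fract_hom.mat_hom_one .
  thus ?thesis by (rule to_fract_hom.mat_hom_inj)
qed

text \<open>
  Dual minimal bases extend to a pair of mutually inverse unimodular matrices, with block rows
  \<open>U, K\<close> and block columns \<open>N\<^sup>T, W\<close>. If \<open>W\<close> and \<open>Y\<close> are right inverses of \<open>K\<close> and \<open>N\<close>, then
  \<open>U = Y\<^sup>T (1 - W K)\<close> annihilates \<open>W\<close>, and it still inverts \<open>N\<^sup>T\<close> because \<open>K N\<^sup>T = 0\<close>. This proves
  that the product in one order is the identity; the last equation is the product in the other
  order.
\<close>

lemma dual_minimal_bases_completion: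
  fixes K N :: "'a::alg_closed_field poly mat"
  assumes dual: "dual_minimal_bases K N" and K: "K \<in> carrier_mat k (q + k)"
  shows "\<exists>U W. U \<in> carrier_mat q (q + k) \<and> W \<in> carrier_mat (q + k) k \<and>
    N \<in> carrier_mat q (q + k) \<and> K * N\<^sup>T = 0\<^sub>m k q \<and>
    U * N\<^sup>T = 1\<^sub>m q \<and> U * W = 0\<^sub>m q k \<and> K * W = 1\<^sub>m k \<and> N\<^sup>T * U + W * K = 1\<^sub>m (q + k)"
proof -
  let ?l = "q + k"
  have mK: "minimal_basis K" and mN: "minimal_basis N" and N: "N \<in> carrier_mat q ?l"
    and KN: "K * N\<^sup>T = 0\<^sub>m k q"
    using dual K unfolding dual_minimal_bases_def by auto
  have Nt: "N\<^sup>T \<in> carrier_mat ?l q" using N by simp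
  obtain W where W: "W \<in> carrier_mat ?l k" and KW: "K * W = 1\<^sub>m k"
    using minimal_basis_right_inverse[OF mK K] by auto
  obtain Y where Y: "Y \<in> carrier_mat ?l q" and NY: "N * Y = 1\<^sub>m q"
    using minimal_basis_right_inverse[OF mN N] by auto
  have Yt: "Y\<^sup>T \<in> carrier_mat q ?l" using Y by simp
  have YN: "Y\<^sup>T * N\<^sup>T = 1\<^sub>m q" using transpose_mult[OF N Y] NY by simp
  have WK: "W * K \<in> carrier_mat ?l ?l" using W K by simp
  \<comment> \<open>The projection \<open>1 - W K\<close> annihilates \<open>W\<close> and fixes \<open>N\<^sup>T\<close>.\<close>
  define U where "U = Y\<^sup>T * (1\<^sub>m ?l - W * K)"
  have U: "U \<in> carrier_mat q ?l" unfolding U_def by (rule mult_carrier_mat[OF Yt minus_carrier_mat[OF WK]])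
  have "(1\<^sub>m ?l - W * K) * N\<^sup>T = N\<^sup>T"
  proof -
    have "(1\<^sub>m ?l - W * K) * N\<^sup>T = 1\<^sub>m ?l * N\<^sup>T - W * K * N\<^sup>T"
      by (rule minus_mult_distrib_mat[OF _ WK Nt]) simp
    also have "W * K * N\<^sup>T = 0\<^sub>m ?l q" using assoc_mult_mat[OF W K Nt] KN W by simp
    finally show ?thesis using Nt N by auto
  qed
  hence UN: "U * N\<^sup>T = 1\<^sub>m q"
    unfolding U_def using assoc_mult_mat[OF Yt minus_carrier_mat[OF WK] Nt] YN by simp
  have "(1\<^sub>m ?l - W * K) * W = 0\<^sub>m ?l k"
  proof -
    have "(1\<^sub>m ?l - W * K) * W = 1\<^sub>m ?l * W - W * K * W"
      by (rule minus_mult_distrib_mat[OF _ WK W]) simp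
    also have "W * K * W = W" using assoc_mult_mat[OF W K W] KW W by simp
    finally show ?thesis using W by auto
  qed
  hence UW: "U * W = 0\<^sub>m q k"
    unfolding U_def using assoc_mult_mat[OF Yt minus_carrier_mat[OF WK] W] right_mult_zero_mat[OF Yt] by simp
  \<comment> \<open>The empty blocks turn the two stacked matrices into instances of the block product rule.\<close>
  let ?E = "four_block_mat U (0\<^sub>m q 0) K (0\<^sub>m k 0)"
  let ?F = "four_block_mat (N\<^sup>T) W (0\<^sub>m 0 q) (0\<^sub>m 0 k)"
  have E: "?E \<in> carrier_mat ?l ?l" and F: "?F \<in> carrier_mat ?l ?l"
    using four_block_carrier_mat[OF U, of "0\<^sub>m k 0" k 0] four_block_carrier_mat[OF Nt, of "0\<^sub>m 0 k" 0 k] by auto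
  have "?E * ?F = 1\<^sub>m ?l"
    by (subst mult_four_block_mat[OF U _ K _ Nt W]) (auto simp: UN UW KN KW)
  hence "?F * ?E = 1\<^sub>m ?l" by (rule poly_mat_left_right_inverse[OF E F])
  moreover have "?F * ?E = four_block_mat (N\<^sup>T * U + W * K) (0\<^sub>m ?l 0) (0\<^sub>m 0 ?l) (0\<^sub>m 0 0)"
    using Nt W U K
    by (subst mult_four_block_mat[OF Nt W _ _ U _ K]) (auto intro!: cong_four_block_mat eq_matI)
  ultimately have "four_block_mat (N\<^sup>T * U + W * K) (0\<^sub>m ?l 0) (0\<^sub>m 0 ?l) (0\<^sub>m 0 0) = 1\<^sub>m ?l" by simp
  moreover have "four_block_mat (N\<^sup>T * U + W * K) (0\<^sub>m ?l 0) (0\<^sub>m 0 ?l) (0\<^sub>m 0 0) = N\<^sup>T * U + W * K"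
    using Nt W U K by (intro eq_matI) auto
  ultimately have "N\<^sup>T * U + W * K = 1\<^sub>m ?l" by simp
  with U W N KN UN UW KW show ?thesis by blast
qed

section \<open>Eigenvalues and regularity in a set\<close>

text \<open>
  The next four lemmas express the absence of eigenvalues without ranks: a matrix of full row rank
  is handled through right inverses of its values, one of full column rank through their kernels.
\<close>

lemma no_eigenvalues_right_inverse:
  fixes G :: "'a::field poly mat"
  assumes G: "G \<in> carrier_mat k l" and ne: "no_eigenvalues_in \<Omega> G" and x: "x \<in> \<Omega>"
    and nr: "normal_rank G = k"
  shows "\<exists>V\<in>carrier_mat l k. map_mat (\<lambda>q. poly q x) G * V = 1\<^sub>m k"
proof -
  interpret vec_space "TYPE('a)" k .
  have "k \<le> rank (map_mat (\<lambda>q. poly q x) G)"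
    using ne x nr G unfolding no_eigenvalues_in_def poly_mat_eigenvalue_def rank_at_def by auto
  thus ?thesis using G by (intro right_inverse_if_full_rank) auto
qed

lemma no_eigenvalues_if_right_inverse:
  fixes G :: "'a::field poly mat"
  assumes G: "G \<in> carrier_mat k l"
    and V: "\<And>x. x \<in> \<Omega> \<Longrightarrow> \<exists>V\<in>carrier_mat l k. map_mat (\<lambda>q. poly q x) G * V = 1\<^sub>m k"
  shows "no_eigenvalues_in \<Omega> G"
  unfolding no_eigenvalues_in_def poly_mat_eigenvalue_def
proof
  fix x assume "x \<in> \<Omega>"
  then obtain V where "V \<in> carrier_mat l k" "map_mat (\<lambda>q. poly q x) G * V = 1\<^sub>m k"
    using V by blast
  hence "rank_at G x = k"
    unfolding rank_at_def using G by (simp add: vec_space.full_rank_if_right_inverse[of _ _ l])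
  moreover have "normal_rank G \<le> k"
    unfolding normal_rank_def using G by (simp add: vec_space.rank_le_dim[of _ _ l])
  ultimately show "\<not> rank_at G x < normal_rank G" by simp
qed

lemma no_eigenvalues_kernel:
  fixes G :: "'a::field poly mat"
  assumes G: "G \<in> carrier_mat k l" and ne: "no_eigenvalues_in \<Omega> G" and x: "x \<in> \<Omega>"
    and nr: "normal_rank G = l"
    and v: "v \<in> carrier_vec l" "map_mat (\<lambda>q. poly q x) G *\<^sub>v v = 0\<^sub>v k"
  shows "v = 0\<^sub>v l"
proof -
  interpret vec_space "TYPE('a)" k .
  have "l \<le> rank (map_mat (\<lambda>q. poly q x) G)"
    using ne x nr G unfolding no_eigenvalues_in_def poly_mat_eigenvalue_def rank_at_def by auto
  moreover have "map_mat (\<lambda>q. poly q x) G \<in> carrier_mat k l" using G by simp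
  ultimately show ?thesis using kernel_trivial_if_full_rank v by blast
qed

lemma no_eigenvalues_if_kernel_trivial:
  fixes G :: "'a::field poly mat"
  assumes G: "G \<in> carrier_mat k l"
    and inj: "\<And>x v. x \<in> \<Omega> \<Longrightarrow> v \<in> carrier_vec l \<Longrightarrow>
      map_mat (\<lambda>q. poly q x) G *\<^sub>v v = 0\<^sub>v k \<Longrightarrow> v = 0\<^sub>v l"
  shows "no_eigenvalues_in \<Omega> G"
  unfolding no_eigenvalues_in_def poly_mat_eigenvalue_def
proof
  fix x assume x: "x \<in> \<Omega>"
  interpret vec_space "TYPE('a)" k .
  have Gx: "map_mat (\<lambda>q. poly q x) G \<in> carrier_mat k l" using G by simp
  have "rank_at G x = l"
    unfolding rank_at_def using G columns_independent_if_kernel_trivial[OF Gx inj[OF x]]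
    by (simp add: lin_indpt_full_rank[OF Gx])
  moreover have "normal_rank G \<le> l"
    unfolding normal_rank_def using G by (simp add: vec_space.rank_le_nc[of _ _ l])
  ultimately show "\<not> rank_at G x < normal_rank G" by simp
qed

lemma normal_rank_append_cols:
  fixes A :: "'a::field poly mat"
  assumes A: "A \<in> carrier_mat n n" and d: "det A \<noteq> 0" and B: "B \<in> carrier_mat n m"
  shows "normal_rank (A @\<^sub>c B) = n"
proof -
  let ?A = "rat_mat A"
  have rA: "?A \<in> carrier_mat n n" using A by simp
  have dr: "det ?A \<noteq> 0" using d by simp
  obtain Ai where Ai: "Ai \<in> carrier_mat n n" "?A * Ai = 1\<^sub>m n"
    using det_non_zero_imp_unit[OF rA dr, of undefined] unfolding Units_def ring_mat_def by auto
  have "rat_mat (A @\<^sub>c B) = ?A @\<^sub>c rat_mat B"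
    using A B by (intro eq_matI) (auto simp: append_cols_def)
  hence "rat_mat (A @\<^sub>c B) * (Ai @\<^sub>r 0\<^sub>m m n) = 1\<^sub>m n"
    using append_cols_mult_append_rows[OF rA _ Ai(1), of "rat_mat B" m "0\<^sub>m m n"] B Ai by simp
  moreover have "rat_mat (A @\<^sub>c B) \<in> carrier_mat n (n + m)" using A B by simp
  moreover have "Ai @\<^sub>r 0\<^sub>m m n \<in> carrier_mat (n + m) n" using Ai by simp
  ultimately have "vec_space.rank n (rat_mat (A @\<^sub>c B)) = n"
    by (metis vec_space.full_rank_if_right_inverse)
  thus ?thesis unfolding normal_rank_def using A B by (simp add: append_cols_def)
qed

lemma normal_rank_append_rows:
  fixes A :: "'a::field poly mat"
  assumes A: "A \<in> carrier_mat n n" and d: "det A \<noteq> 0" and C: "C \<in> carrier_mat p n"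
  shows "normal_rank (A @\<^sub>r C) = n"
proof -
  interpret vec_space "TYPE('a poly fract)" "n + p" .
  have rA: "rat_mat A \<in> carrier_mat n n" and rC: "rat_mat C \<in> carrier_mat p n" using A C by auto
  have dr: "det (rat_mat A) \<noteq> 0" using d by simp
  have G: "rat_mat (A @\<^sub>r C) \<in> carrier_mat (n + p) n" using A C by simp
  have "v = 0\<^sub>v n" if v: "v \<in> carrier_vec n" "rat_mat (A @\<^sub>r C) *\<^sub>v v = 0\<^sub>v (n + p)" for v
  proof -
    have "(rat_mat A *\<^sub>v v) @\<^sub>v (rat_mat C *\<^sub>v v) = 0\<^sub>v n @\<^sub>v 0\<^sub>v p"
      using v(2) unfolding map_append_rows[OF A C] mat_mult_append[OF rA rC v(1)]
      by (auto intro!: eq_vecI)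
    hence "rat_mat A *\<^sub>v v = 0\<^sub>v n" using rA v(1) by (subst (asm) append_vec_eq[of _ n]) auto
    thus ?thesis using det_0_iff_vec_prod_zero_field[OF rA] dr v(1) by blast
  qed
  hence "rank (rat_mat (A @\<^sub>r C)) = n"
    using columns_independent_if_kernel_trivial[OF G] lin_indpt_full_rank[OF G] by blast
  thus ?thesis unfolding normal_rank_def using A C by (simp add: append_rows_def)
qed

lemma right_inverse_at_if_scaled:
  fixes G :: "'a::field poly mat"
  assumes G: "G \<in> carrier_mat k l" and Q: "Q \<in> carrier_mat l k" and H: "G * Q = H"
    and d: "poly (det H) x \<noteq> 0"
  shows "\<exists>V\<in>carrier_mat l k. map_mat (\<lambda>q. poly q x) G * V = 1\<^sub>m k"
proof -
  let ?e = "map_mat (\<lambda>q. poly q x)"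
  have Hc: "?e H \<in> carrier_mat k k" using G Q H by auto
  have "det (?e H) \<noteq> 0" using d by (simp add: eval_mat_det)
  then obtain X where X: "X \<in> carrier_mat k k" "?e H * X = 1\<^sub>m k"
    using det_non_zero_imp_unit[OF Hc, of undefined] unfolding Units_def ring_mat_def by auto
  have "?e G * (?e Q * X) = 1\<^sub>m k"
    using assoc_mult_mat[of "?e G" k l "?e Q" k X k] G Q X H eval_mat_mult[OF G Q] by simp
  thus ?thesis using Q X by (intro bexI[of _ "?e Q * X"]) auto
qed

text \<open>
  All the transformations below have a common denominator \<open>g\<close>. If neither \<open>g\<close> nor the
  determinant of the numerator vanishes at \<open>x\<close>, then the value \<open>P(x) / g(x)\<close> is invertible.
\<close>

lemma regular_in_scaled:
  fixes P :: "'a::field poly mat"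
  assumes P: "P \<in> carrier_mat r r" and g: "\<And>x. x \<in> \<Omega> \<Longrightarrow> poly g x \<noteq> 0"
    and d: "\<And>x. x \<in> \<Omega> \<Longrightarrow> poly (det P) x \<noteq> 0"
  shows "regular_in \<Omega> (inverse (to_fract g) \<cdot>\<^sub>m rat_mat P)"
  unfolding regular_in_def
proof (intro conjI ballI)
  show "square_mat (inverse (to_fract g) \<cdot>\<^sub>m rat_mat P)" using P by simp
next
  fix x assume x: "x \<in> \<Omega>"
  let ?e = "map_mat (\<lambda>q. poly q x)"
  define V where "V = inverse (poly g x) \<cdot>\<^sub>m ?e P"
  have eP: "?e P \<in> carrier_mat r r" using P by simp
  have V: "V \<in> carrier_mat r r" using P by (simp add: V_def)
  have "det (?e P) \<noteq> 0" using d[OF x] by (simp add: eval_mat_det)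
  then obtain X where X: "X \<in> carrier_mat r r" "?e P * X = 1\<^sub>m r" "X * ?e P = 1\<^sub>m r"
    using det_non_zero_imp_unit[OF eP, of undefined] unfolding Units_def ring_mat_def by auto
  have c: "poly g x * (inverse (poly g x)) = 1" "inverse (poly g x) * poly g x = 1" using g[OF x] by auto
  have "V * (poly g x \<cdot>\<^sub>m X) = 1\<^sub>m r" "(poly g x \<cdot>\<^sub>m X) * V = 1\<^sub>m r"
    using mult_smult_distrib[OF V X(1), of "poly g x"] mult_smult_distrib[OF X(1) eP, of "inverse (poly g x)"]
      mult_smult_assoc_mat[OF eP X(1), of "inverse (poly g x)"] mult_smult_assoc_mat[OF X(1) V, of "poly g x"] c
    by (auto simp: X V_def intro!: eq_matI)
  hence "invertible_mat V"
    using V X by (auto simp: invertible_mat_def inverts_mat_def intro!: exI[of _ "poly g x \<cdot>\<^sub>m X"])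
  moreover have "has_value_at ((inverse (to_fract g) \<cdot>\<^sub>m rat_mat P) $$ (i, j)) x (V $$ (i, j))"
    if "i < r" "j < r" for i j
    unfolding has_value_at_def
    by (rule exI[of _ "P $$ (i, j)"], rule exI[of _ g])
      (use that P g[OF x] in \<open>auto simp: V_def field_simps\<close>)
  ultimately show "\<exists>V\<in>carrier_mat (dim_row (inverse (to_fract g) \<cdot>\<^sub>m rat_mat P))
      (dim_col (inverse (to_fract g) \<cdot>\<^sub>m rat_mat P)).
      (\<forall>i<dim_row (inverse (to_fract g) \<cdot>\<^sub>m rat_mat P). \<forall>j<dim_col (inverse (to_fract g) \<cdot>\<^sub>m rat_mat P).
        has_value_at ((inverse (to_fract g) \<cdot>\<^sub>m rat_mat P) $$ (i, j)) x (V $$ (i, j))) \<and>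
      invertible_mat V"
    using V P by (intro bexI[of _ V]) auto
qed

text \<open>
  As \<open>det A \<noteq> 0\<close>, the normal rank of the matrix with blocks \<open>A, B\<close> is \<open>n\<close>, so without eigenvalues
  its values on \<open>\<Omega>\<close> have full row rank. The adjugate of \<open>A\<close>, extended by zero rows, shows that the
  ideal of denominators contains \<open>det A\<close>.
\<close>

lemma bezout_identity:
  fixes A :: "'a::field poly mat"
  assumes A: "A \<in> carrier_mat n n" and dA: "det A \<noteq> 0" and B: "B \<in> carrier_mat n m"
    and ne: "no_eigenvalues_in \<Omega> (A @\<^sub>c B)"
  obtains S T g where "S \<in> carrier_mat n n" "T \<in> carrier_mat m n" "A * S + B * T = g \<cdot>\<^sub>m 1\<^sub>m n"
    "g \<noteq> 0" "\<forall>x\<in>\<Omega>. poly g x \<noteq> 0"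
proof -
  have G: "A @\<^sub>c B \<in> carrier_mat n (n + m)" using A B by simp
  have W0: "adj_mat A @\<^sub>r 0\<^sub>m m n \<in> carrier_mat (n + m) n" using adj_mat(1)[OF A] by simp
  have "(A @\<^sub>c B) * (adj_mat A @\<^sub>r 0\<^sub>m m n) = A * adj_mat A + B * 0\<^sub>m m n"
    by (rule append_cols_mult_append_rows[OF A B adj_mat(1)[OF A] zero_carrier_mat])
  also have "\<dots> = det A \<cdot>\<^sub>m 1\<^sub>m n" unfolding adj_mat(2)[OF A] using B by simp
  finally have GW0: "(A @\<^sub>c B) * (adj_mat A @\<^sub>r 0\<^sub>m m n) = det A \<cdot>\<^sub>m 1\<^sub>m n" .
  note pt = no_eigenvalues_right_inverse[OF G ne _ normal_rank_append_cols[OF A dA B]]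
  from scaled_right_inverse_on[OF G pt W0 GW0 dA]
  obtain g W where W: "W \<in> carrier_mat (n + m) n" and GW: "(A @\<^sub>c B) * W = g \<cdot>\<^sub>m 1\<^sub>m n"
    and g: "g \<noteq> 0" "\<forall>x\<in>\<Omega>. poly g x \<noteq> 0" by blast
  obtain S T where S: "S \<in> carrier_mat n n" and T: "T \<in> carrier_mat m n" and "W = S @\<^sub>r T"
    by (rule append_rows_split[OF W])
  with GW have "A * S + B * T = g \<cdot>\<^sub>m 1\<^sub>m n" using append_cols_mult_append_rows[OF A B S T] by simp
  with S T g that show thesis by blast
qed

section \<open>Minimality of the system matrix\<close>

text \<open>
  Multiplication by the matrix with block columns \<open>Nt, W\<close> makes the pencil block triangular, with
  diagonal blocks \<open>M * Nt\<close> and the identity.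
\<close>

lemma pencil_det_nonzero:
  fixes M :: "'a::idom mat"
  assumes M: "M \<in> carrier_mat n (n + k)" and K: "K \<in> carrier_mat k (n + k)"
    and Nt: "Nt \<in> carrier_mat (n + k) n" and W: "W \<in> carrier_mat (n + k) k"
    and KN: "K * Nt = 0\<^sub>m k n" and KW: "K * W = 1\<^sub>m k" and d: "det (M * Nt) \<noteq> 0"
  shows "det (M @\<^sub>r K) \<noteq> 0"
proof -
  have "det (M @\<^sub>r K) * det (Nt @\<^sub>c W) = det ((M @\<^sub>r K) * (Nt @\<^sub>c W))"
    using M K Nt W by (intro det_mult[symmetric, of _ "n + k"]) auto
  also have "\<dots> = det (M * Nt) * det (1\<^sub>m k :: 'a mat)"
    unfolding append_rows_mult_append_cols[OF M K Nt W] KN KW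
    using M Nt W by (intro det_four_block_mat_lower_left_zero[of _ n _ k]) auto
  finally show ?thesis using d by auto
qed

text \<open>
  The upper block row of the system matrix sends the columns \<open>(Nt S, Nt' T)\<close> to \<open>(g, 0)\<close>, by the Bezout
  identity, and the columns \<open>(W, 0)\<close> to \<open>(MA W, 1)\<close>. Together these images form a block triangular
  matrix with determinant \<open>g\<^sup>n\<close>, which does not vanish on \<open>\<Omega>\<close>.
\<close>

lemma pencil_controllable:
  fixes A :: "'a::field poly mat"
  assumes MA: "MA \<in> carrier_mat n (n + k)" and KA: "KA \<in> carrier_mat k (n + k)"
    and Nt: "Nt \<in> carrier_mat (n + k) n" and W: "W \<in> carrier_mat (n + k) k"
    and MB: "MB \<in> carrier_mat n l" and Nt': "Nt' \<in> carrier_mat l m"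
    and KN: "KA * Nt = 0\<^sub>m k n" and KW: "KA * W = 1\<^sub>m k"
    and A: "MA * Nt = A" and B: "MB * Nt' = B"
    and S: "S \<in> carrier_mat n n" and T: "T \<in> carrier_mat m n"
    and bezout: "A * S + B * T = g \<cdot>\<^sub>m 1\<^sub>m n" and g: "\<And>x. x \<in> \<Omega> \<Longrightarrow> poly g x \<noteq> 0"
  shows "no_eigenvalues_in \<Omega> ((MA @\<^sub>r KA) @\<^sub>c (MB @\<^sub>r 0\<^sub>m k l))"
proof (rule no_eigenvalues_if_right_inverse)
  let ?G = "(MA @\<^sub>r KA) @\<^sub>c (MB @\<^sub>r 0\<^sub>m k l)"
  show Gc: "?G \<in> carrier_mat (n + k) ((n + k) + l)" using MA KA MB by simp
  have G: "?G = four_block_mat MA MB KA (0\<^sub>m k l)"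
    using MA KA MB by (intro eq_matI) (auto simp: append_rows_def append_cols_def)
  have NS: "Nt * S \<in> carrier_mat (n + k) n" and NT: "Nt' * T \<in> carrier_mat l n"
    using Nt S Nt' T by auto
  let ?Q = "four_block_mat (Nt * S) W (Nt' * T) (0\<^sub>m l k)"
  have Q: "?Q \<in> carrier_mat ((n + k) + l) (n + k)" using NS by (intro four_block_carrier_mat) auto
  have "MA * (Nt * S) + MB * (Nt' * T) = g \<cdot>\<^sub>m 1\<^sub>m n"
    unfolding assoc_mult_mat[OF MA Nt S, symmetric] assoc_mult_mat[OF MB Nt' T, symmetric] A B bezout ..
  moreover have "MA * W + MB * 0\<^sub>m l k = MA * W" using MA MB W by auto
  moreover have "KA * (Nt * S) + 0\<^sub>m k l * (Nt' * T) = 0\<^sub>m k n"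
    unfolding assoc_mult_mat[OF KA Nt S, symmetric] KN left_mult_zero_mat[OF NT] left_mult_zero_mat[OF S] by simp
  moreover have "KA * W + 0\<^sub>m k l * 0\<^sub>m l k = 1\<^sub>m k" unfolding KW by simp
  ultimately have GQ: "?G * ?Q = four_block_mat (g \<cdot>\<^sub>m 1\<^sub>m n) (MA * W) (0\<^sub>m k n) (1\<^sub>m k)"
    unfolding G by (simp only: mult_four_block_mat[OF MA MB KA zero_carrier_mat NS W NT zero_carrier_mat])
  have "det (four_block_mat (g \<cdot>\<^sub>m 1\<^sub>m n) (MA * W) (0\<^sub>m k n) (1\<^sub>m k)) = g ^ n"
    using MA W by (subst det_four_block_mat_lower_left_zero[of _ n _ k]) (auto simp: det_smult_one)
  thus "\<exists>V\<in>carrier_mat ((n + k) + l) (n + k). map_mat (\<lambda>q. poly q x) ?G * V = 1\<^sub>m (n + k)"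
    if "x \<in> \<Omega>" for x
    using g[OF that] by (intro right_inverse_at_if_scaled[OF Gc Q GQ]) simp
qed

text \<open>
  A vector in the kernel of \<open>K\<close> has the form \<open>v = Nt w\<close> with \<open>w = U v\<close>, and on such vectors \<open>M\<close> and
  \<open>P\<close> act as \<open>M Nt\<close> and \<open>P Nt\<close> do on \<open>w\<close>.
\<close>

lemma observability_kernel:
  fixes M :: "'a::comm_ring_1 mat"
  assumes M: "M \<in> carrier_mat n l" and K: "K \<in> carrier_mat k l" and P: "P \<in> carrier_mat p l"
    and Nt: "Nt \<in> carrier_mat l n" and U: "U \<in> carrier_mat n l" and W: "W \<in> carrier_mat l k"
    and comp: "Nt * U + W * K = 1\<^sub>m l"
    and inj: "\<And>w. w \<in> carrier_vec n \<Longrightarrow> (M * Nt) *\<^sub>v w = 0\<^sub>v n \<Longrightarrow> (P * Nt) *\<^sub>v w = 0\<^sub>v p \<Longrightarrow> w = 0\<^sub>v n"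
    and v: "v \<in> carrier_vec l" and Mv: "M *\<^sub>v v = 0\<^sub>v n" and Kv: "K *\<^sub>v v = 0\<^sub>v k" and Pv: "P *\<^sub>v v = 0\<^sub>v p"
  shows "v = 0\<^sub>v l"
proof -
  have Uv: "U *\<^sub>v v \<in> carrier_vec n" using U v by simp
  have "v = (Nt * U + W * K) *\<^sub>v v" unfolding comp using v by simp
  also have "\<dots> = (Nt * U) *\<^sub>v v + (W * K) *\<^sub>v v"
    using Nt U W K v by (intro add_mult_distrib_mat_vec) auto
  also have "(W * K) *\<^sub>v v = 0\<^sub>v l" using assoc_mult_mat_vec[OF W K v] Kv W by auto
  also have "(Nt * U) *\<^sub>v v = Nt *\<^sub>v (U *\<^sub>v v)" by (rule assoc_mult_mat_vec[OF Nt U v])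
  finally have vw: "v = Nt *\<^sub>v (U *\<^sub>v v)" using Nt Uv by (metis mult_mat_vec_carrier right_zero_vec)
  have "U *\<^sub>v v = 0\<^sub>v n"
    using assoc_mult_mat_vec[OF M Nt Uv] assoc_mult_mat_vec[OF P Nt Uv] vw Mv Pv
    by (intro inj[OF Uv]) simp_all
  hence "v = Nt *\<^sub>v 0\<^sub>v n" using vw by simp
  also have "\<dots> = 0\<^sub>v l" using Nt by (intro eq_vecI) auto
  finally show ?thesis .
qed

text \<open>
  At each point of \<open>\<Omega>\<close> the kernel argument above reduces the claim to the matrix with blocks \<open>A\<close>
  and \<open>C\<close>, whose values have full column rank there.
\<close>

lemma pencil_observable:
  fixes A :: "'a::field poly mat"
  assumes MA: "MA \<in> carrier_mat n l" and KA: "KA \<in> carrier_mat k l" and MC: "MC \<in> carrier_mat p l"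
    and Nt: "Nt \<in> carrier_mat l n" and U: "U \<in> carrier_mat n l" and W: "W \<in> carrier_mat l k"
    and comp: "Nt * U + W * KA = 1\<^sub>m l" and A: "MA * Nt = A" and C: "MC * Nt = C"
    and dA: "det A \<noteq> 0" and ne: "no_eigenvalues_in \<Omega> (A @\<^sub>r C)"
  shows "no_eigenvalues_in \<Omega> ((MA @\<^sub>r KA) @\<^sub>r (MC @\<^sub>r 0\<^sub>m s l))"
proof (rule no_eigenvalues_if_kernel_trivial)
  let ?L = "MA @\<^sub>r KA" and ?C = "MC @\<^sub>r 0\<^sub>m s l :: 'a poly mat"
  have Lc: "?L \<in> carrier_mat (n + k) l" and Cc: "?C \<in> carrier_mat (p + s) l" using MA KA MC by auto
  show "?L @\<^sub>r ?C \<in> carrier_mat ((n + k) + (p + s)) l" using Lc Cc by simp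
  fix x and v :: "'a vec" assume x: "x \<in> \<Omega>" and v: "v \<in> carrier_vec l"
  let ?e = "map_mat (\<lambda>q. poly q x) :: 'a poly mat \<Rightarrow> 'a mat"
  assume z: "?e (?L @\<^sub>r ?C) *\<^sub>v v = 0\<^sub>v ((n + k) + (p + s))"
  have ec: "?e MA \<in> carrier_mat n l" "?e KA \<in> carrier_mat k l" "?e MC \<in> carrier_mat p l"
    "?e (0\<^sub>m s l) \<in> carrier_mat s l" "?e ?L \<in> carrier_mat (n + k) l" "?e ?C \<in> carrier_mat (p + s) l"
    using MA KA MC Lc Cc by auto
  have Ac: "A \<in> carrier_mat n n" and Cc': "C \<in> carrier_mat p n" using A C MA MC Nt by auto
  have "?e ?L *\<^sub>v v = 0\<^sub>v (n + k) \<and> ?e ?C *\<^sub>v v = 0\<^sub>v (p + s)"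
    using z unfolding map_append_rows[OF Lc Cc] mat_mult_append[OF ec(5,6) v]
      append_vec_zero_iff[OF mult_mat_vec_carrier[OF ec(5) v] mult_mat_vec_carrier[OF ec(6) v]] .
  hence "?e MA *\<^sub>v v = 0\<^sub>v n \<and> ?e KA *\<^sub>v v = 0\<^sub>v k" "?e MC *\<^sub>v v = 0\<^sub>v p \<and> ?e (0\<^sub>m s l) *\<^sub>v v = 0\<^sub>v s"
    unfolding map_append_rows[OF MA KA] mat_mult_append[OF ec(1,2) v]
      map_append_rows[OF MC zero_carrier_mat] mat_mult_append[OF ec(3,4) v]
      append_vec_zero_iff[OF mult_mat_vec_carrier[OF ec(1) v] mult_mat_vec_carrier[OF ec(2) v]]
      append_vec_zero_iff[OF mult_mat_vec_carrier[OF ec(3) v] mult_mat_vec_carrier[OF ec(4) v]] by blast+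
  hence z: "?e MA *\<^sub>v v = 0\<^sub>v n" "?e KA *\<^sub>v v = 0\<^sub>v k" "?e MC *\<^sub>v v = 0\<^sub>v p" by auto
  have comp': "?e Nt * ?e U + ?e W * ?e KA = 1\<^sub>m l"
  proof -
    have "?e (Nt * U + W * KA) = ?e (Nt * U) + ?e (W * KA)"
      using Nt U W KA by (intro eq_matI) (auto simp del: index_mult_mat(1))
    thus ?thesis unfolding comp eval_mat_one eval_mat_mult[OF Nt U] eval_mat_mult[OF W KA] by simp
  qed
  show "v = 0\<^sub>v l"
  proof (rule observability_kernel[OF ec(1,2,3) _ _ _ comp' _ v z])
    fix w assume w: "w \<in> carrier_vec n" and "(?e MA * ?e Nt) *\<^sub>v w = 0\<^sub>v n" "(?e MC * ?e Nt) *\<^sub>v w = 0\<^sub>v p"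
    hence "?e A *\<^sub>v w = 0\<^sub>v n" "?e C *\<^sub>v w = 0\<^sub>v p"
      unfolding eval_mat_mult[OF MA Nt, symmetric] eval_mat_mult[OF MC Nt, symmetric] A C by auto
    hence "?e (A @\<^sub>r C) *\<^sub>v w = 0\<^sub>v (n + p)"
      unfolding map_append_rows[OF Ac Cc'] using Ac Cc' w
      by (subst mat_mult_append[of _ n n _ p]) (auto simp: append_vec_zero_iff)
    thus "w = 0\<^sub>v n"
      using no_eigenvalues_kernel[OF _ ne x normal_rank_append_rows[OF Ac dA Cc'] w] Ac Cc' by auto
  qed (use Nt U W in auto)
qed

section \<open>The transfer function\<close>

text \<open>
  The pencil with blocks \<open>MA, KA\<close> sends \<open>Nt\<close> to \<open>(A, 0)\<close>. Hence its inverse \<open>X\<close> sends \<open>(MB, 0)\<close> to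
  \<open>Nt A\<^sup>-\<^sup>1 MB\<close>, and \<open>MC\<close> sends this to \<open>C A\<^sup>-\<^sup>1 MB\<close>: the auxiliary variables of the pencil for \<open>A\<close>
  leave no trace in the transfer function.
\<close>

lemma transfer_function_reduction:
  fixes A :: "'a::comm_ring_1 mat"
  assumes MA: "MA \<in> carrier_mat n l" and KA: "KA \<in> carrier_mat k l" and Nt: "Nt \<in> carrier_mat l n"
    and MB: "MB \<in> carrier_mat n q" and MC: "MC \<in> carrier_mat p l"
    and MD: "MD \<in> carrier_mat p q" and KD: "KD \<in> carrier_mat s q"
    and A: "A \<in> carrier_mat n n" and Ai: "Ai \<in> carrier_mat n n"
    and X: "X \<in> carrier_mat l (n + k)"
    and MN: "MA * Nt = A" and KN: "KA * Nt = 0\<^sub>m k n" and CN: "MC * Nt = C"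
    and AAi: "A * Ai = 1\<^sub>m n" and XL: "X * (MA @\<^sub>r KA) = 1\<^sub>m l"
  shows "(MD @\<^sub>r KD) + (MC @\<^sub>r 0\<^sub>m s l) * X * (MB @\<^sub>r 0\<^sub>m k q) = (MD + C * (Ai * MB)) @\<^sub>r KD"
proof -
  have L: "MA @\<^sub>r KA \<in> carrier_mat (n + k) l" using MA KA by simp
  have AB: "Ai * MB \<in> carrier_mat n q" using Ai MB by simp
  have NAB: "Nt * (Ai * MB) \<in> carrier_mat l q" using Nt AB by simp
  have "(MA @\<^sub>r KA) * (Nt * (Ai * MB)) = (A * (Ai * MB)) @\<^sub>r (0\<^sub>m k n * (Ai * MB))"
    unfolding append_rows_mult[OF MA KA NAB] assoc_mult_mat[OF MA Nt AB, symmetric]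
      assoc_mult_mat[OF KA Nt AB, symmetric] MN KN ..
  also have "A * (Ai * MB) = MB" unfolding assoc_mult_mat[OF A Ai MB, symmetric] AAi using MB by simp
  also have "0\<^sub>m k n * (Ai * MB) = 0\<^sub>m k q" by (rule left_mult_zero_mat[OF AB])
  finally have L_eq: "(MA @\<^sub>r KA) * (Nt * (Ai * MB)) = MB @\<^sub>r 0\<^sub>m k q" .
  have "X * (MB @\<^sub>r 0\<^sub>m k q) = Nt * (Ai * MB)"
    unfolding L_eq[symmetric] assoc_mult_mat[OF X L NAB, symmetric] XL by (rule left_mult_one_mat[OF NAB])
  hence "(MC @\<^sub>r 0\<^sub>m s l) * X * (MB @\<^sub>r 0\<^sub>m k q) = (MC @\<^sub>r 0\<^sub>m s l) * (Nt * (Ai * MB))"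
    using MC MB X by (subst assoc_mult_mat[of _ "p + s" l _ "n + k" _ q]) auto
  also have "\<dots> = (C * (Ai * MB)) @\<^sub>r 0\<^sub>m s q"
    unfolding append_rows_mult[OF MC zero_carrier_mat NAB] assoc_mult_mat[OF MC Nt AB, symmetric] CN
      left_mult_zero_mat[OF NAB] ..
  finally show ?thesis
    using MC Nt AB CN KD by (auto simp: append_rows_add[OF MD KD])
qed

text \<open>
  The reduced transfer function has block rows \<open>MD + C A\<^sup>-\<^sup>1 MB\<close> and \<open>K\<close>. Multiplied by the
  unimodular matrix with block columns \<open>Nt, W\<close>, it becomes block triangular with diagonal blocks
  \<open>R\<close> and the identity and with upper right block \<open>MD W + C A\<^sup>-\<^sup>1 Y\<close>, where \<open>Y = MB W\<close>. For rational
  functions this block may have poles where \<open>det A\<close> vanishes, and then the row operation that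
  removes it is not regular there. But by \<open>A S + B T = 1\<close> one has
  \<open>C A\<^sup>-\<^sup>1 Y = C S Y + C A\<^sup>-\<^sup>1 B T Y = C S Y - D T Y + R T Y\<close>.
  The term \<open>R T Y\<close> is removed by a column operation with \<open>T Y\<close>, and what is left is the block \<open>Z\<close>,
  removed by a row operation; neither uses \<open>A\<^sup>-\<^sup>1\<close>. The identity below is the upper block row of
  the resulting equation.
\<close>

lemma equivalence_identity:
  fixes A :: "'a::comm_ring_1 mat"
  assumes A: "A \<in> carrier_mat n n" and Ai: "Ai \<in> carrier_mat n n" and B: "B \<in> carrier_mat n m"
    and C: "C \<in> carrier_mat p n" and D: "D \<in> carrier_mat p m"
    and MB: "MB \<in> carrier_mat n l" and MD: "MD \<in> carrier_mat p l" and K: "K \<in> carrier_mat k l"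
    and Nt: "Nt \<in> carrier_mat l m" and U: "U \<in> carrier_mat m l" and W: "W \<in> carrier_mat l k"
    and S: "S \<in> carrier_mat n n" and T: "T \<in> carrier_mat m n"
    and Dd: "MD * Nt = D" and Bd: "MB * Nt = B" and comp: "Nt * U + W * K = 1\<^sub>m l"
    and AiA: "Ai * A = 1\<^sub>m n" and bezout: "A * S + B * T = 1\<^sub>m n"
    and Yd: "Y = MB * W" and Zd: "Z = MD * W + C * (S * Y) - D * (T * Y)"
    and Rd: "R = D + C * (Ai * B)"
  shows "R * (U + T * (Y * K)) + Z * K = MD + C * (Ai * MB)"
proof -
  define Q where "Q = Y * K"
  define H where "H = C * Ai"
  have Y: "Y \<in> carrier_mat n k" using MB W by (simp add: Yd)
  have Q: "Q \<in> carrier_mat n l" using Y K by (simp add: Q_def)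
  have H: "H \<in> carrier_mat p n" using C Ai by (simp add: H_def)
  have R: "R = D + H * B" unfolding Rd H_def using assoc_mult_mat[OF C Ai B] by simp
  have Rc: "R \<in> carrier_mat p m" using D H B by (simp add: R)
  have HA: "H * A = C" unfolding H_def assoc_mult_mat[OF C Ai A] AiA by (rule right_mult_one_mat[OF C])
  have TQ: "T * Q \<in> carrier_mat m l" and SQ: "S * Q \<in> carrier_mat n l"
    and BTQ: "B * (T * Q) \<in> carrier_mat n l" and ASQ: "A * (S * Q) \<in> carrier_mat n l"
    and NU: "Nt * U \<in> carrier_mat l l" and WK: "W * K \<in> carrier_mat l l"
    and BU: "B * U \<in> carrier_mat n l"
    using T Q S B A Nt U W K by auto
  have R_mult: "R * G = D * G + H * (B * G)" if G: "G \<in> carrier_mat m l" for G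
    unfolding R using add_mult_distrib_mat[OF D _ G, of "H * B"] assoc_mult_mat[OF H B G] H B by simp
  have CSQ: "C * (S * Q) = H * (A * (S * Q))"
    unfolding assoc_mult_mat[OF H A SQ, symmetric] HA ..
  have "Z * K = MD * W * K + C * (S * Y) * K - D * (T * Y) * K"
    unfolding Zd using MD W C S Y D T K
    by (subst minus_mult_distrib_mat[of _ p k _ _ l], simp, simp, simp,
        subst add_mult_distrib_mat[of _ p k _ _ l], auto)
  also have "MD * W * K = MD * (W * K)" by (rule assoc_mult_mat[OF MD W K])
  also have "C * (S * Y) * K = C * (S * Q)"
    unfolding Q_def using assoc_mult_mat[OF C mult_carrier_mat[OF S Y] K] assoc_mult_mat[OF S Y K] by simp
  also have "D * (T * Y) * K = D * (T * Q)"
    unfolding Q_def using assoc_mult_mat[OF D mult_carrier_mat[OF T Y] K] assoc_mult_mat[OF T Y K] by simp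
  finally have ZK: "Z * K = MD * (W * K) + H * (A * (S * Q)) - D * (T * Q)" unfolding CSQ .
  have "R * (U + T * Q) = R * U + R * (T * Q)" by (rule mult_add_distrib_mat[OF Rc U TQ])
  hence RX: "R * (U + T * Q) = (D * U + H * (B * U)) + (D * (T * Q) + H * (B * (T * Q)))"
    unfolding R_mult[OF U] R_mult[OF TQ] .
  have "Q = A * (S * Q) + B * (T * Q)"
  proof -
    have "Q = (A * S + B * T) * Q" unfolding bezout using Q by simp
    also have "\<dots> = A * S * Q + B * T * Q" using A S B T Q by (intro add_mult_distrib_mat) auto
    finally show ?thesis unfolding assoc_mult_mat[OF A S Q] assoc_mult_mat[OF B T Q] .
  qed
  hence HQ: "H * (A * (S * Q)) + H * (B * (T * Q)) = H * Q"
    using mult_add_distrib_mat[OF H ASQ BTQ] by simp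
  have "D * U = MD * (Nt * U)" unfolding Dd[symmetric] by (rule assoc_mult_mat[OF MD Nt U])
  hence MDs: "D * U + MD * (W * K) = MD"
    using mult_add_distrib_mat[OF MD NU WK] comp MD by simp
  have "B * U = MB * (Nt * U)" unfolding Bd[symmetric] by (rule assoc_mult_mat[OF MB Nt U])
  moreover have "Q = MB * (W * K)" unfolding Q_def Yd by (rule assoc_mult_mat[OF MB W K])
  ultimately have "B * U + Q = MB"
    using mult_add_distrib_mat[OF MB NU WK] comp MB by simp
  hence HMB: "H * (B * U) + H * Q = H * MB" using mult_add_distrib_mat[OF H BU Q] by simp
  have c: "D * U \<in> carrier_mat p l" "H * (B * U) \<in> carrier_mat p l" "D * (T * Q) \<in> carrier_mat p l"
    "H * (B * (T * Q)) \<in> carrier_mat p l" "MD * (W * K) \<in> carrier_mat p l"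
    "H * (A * (S * Q)) \<in> carrier_mat p l"
    using D U H B T Q MD W K A S BU TQ BTQ WK ASQ by (auto simp del: assoc_mult_mat)
  have "R * (U + T * Q) + Z * K =
      (D * U + MD * (W * K)) + (H * (B * U) + (H * (A * (S * Q)) + H * (B * (T * Q))))"
    unfolding RX ZK using c by (rule mat_sum_rearrange)
  thus ?thesis
    unfolding MDs HQ HMB unfolding Q_def H_def using assoc_mult_mat[OF C Ai MB] by simp
qed

text \<open>
  The transformations are the row operation with \<open>Z\<close> and the column operation with \<open>T Y\<close> followed by
  the unimodular matrix with block rows \<open>U, K\<close>. Here \<open>S\<close> and \<open>T\<close> solve the Bezout identity only up
  to the factor \<open>g\<close>, so both transformations have denominator \<open>g\<close>. Their numerators have
  determinants that are powers of \<open>g\<close> up to a unit.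
\<close>

lemma transfer_equivalence:
  fixes A B C D MB MD K Nt U W S T :: "'a::field poly mat"
  assumes A: "A \<in> carrier_mat n n" and dA: "det A \<noteq> 0" and B: "B \<in> carrier_mat n m"
    and C: "C \<in> carrier_mat p n" and D: "D \<in> carrier_mat p m"
    and MB: "MB \<in> carrier_mat n (m + k)" and MD: "MD \<in> carrier_mat p (m + k)"
    and K: "K \<in> carrier_mat k (m + k)"
    and Nt: "Nt \<in> carrier_mat (m + k) m" and U: "U \<in> carrier_mat m (m + k)" and W: "W \<in> carrier_mat (m + k) k"
    and S: "S \<in> carrier_mat n n" and T: "T \<in> carrier_mat m n"
    and Dd: "MD * Nt = D" and Bd: "MB * Nt = B"
    and UN: "U * Nt = 1\<^sub>m m" and UW: "U * W = 0\<^sub>m m k" and KN: "K * Nt = 0\<^sub>m k m" and KW: "K * W = 1\<^sub>m k"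
    and comp: "Nt * U + W * K = 1\<^sub>m (m + k)"
    and bezout: "A * S + B * T = g \<cdot>\<^sub>m 1\<^sub>m n" and g: "g \<noteq> 0" "\<And>x. x \<in> \<Omega> \<Longrightarrow> poly g x \<noteq> 0"
  shows "\<exists>R1 \<in> carrier_mat (p + k) (p + k). \<exists>R2 \<in> carrier_mat (m + k) (m + k).
    regular_in \<Omega> R1 \<and> regular_in \<Omega> R2 \<and>
    R1 * four_block_mat (transfer_function A B C D) (0\<^sub>m p k) (0\<^sub>m k m) (1\<^sub>m k) * R2 =
      (rat_mat MD + rat_mat C * (the (mat_inverse (rat_mat A)) * rat_mat MB)) @\<^sub>r rat_mat K"
proof -
  note hom = to_fract_hom.mat_hom_mult
  have rA: "rat_mat A \<in> carrier_mat n n" and rB: "rat_mat B \<in> carrier_mat n m"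
    and rC: "rat_mat C \<in> carrier_mat p n" and rD: "rat_mat D \<in> carrier_mat p m"
    and rMB: "rat_mat MB \<in> carrier_mat n (m + k)" and rMD: "rat_mat MD \<in> carrier_mat p (m + k)"
    and rK: "rat_mat K \<in> carrier_mat k (m + k)" and rN: "rat_mat Nt \<in> carrier_mat (m + k) m"
    and rU: "rat_mat U \<in> carrier_mat m (m + k)" and rW: "rat_mat W \<in> carrier_mat (m + k) k"
    and rS: "rat_mat S \<in> carrier_mat n n" and rT: "rat_mat T \<in> carrier_mat m n"
    using A B C D MB MD K Nt U W S T by auto
  define Ai where "Ai = the (mat_inverse (rat_mat A))"
  have "det (rat_mat A) \<noteq> 0" using dA by simp
  note Ai = mat_inverse_det_nonzero[OF rA this, folded Ai_def]
  \<comment> \<open>The factor that clears the denominator of the Bezout identity.\<close>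
  define c where "c = inverse (to_fract g)"
  have cg: "c * to_fract g = 1" using g(1) by (simp add: c_def)
  define Sf where "Sf = c \<cdot>\<^sub>m rat_mat S"
  define Tf where "Tf = c \<cdot>\<^sub>m rat_mat T"
  have Sf: "Sf \<in> carrier_mat n n" and Tf: "Tf \<in> carrier_mat m n" using S T by (simp_all add: Sf_def Tf_def)
  have add: "rat_mat (X + Y) = rat_mat X + rat_mat Y" if "X \<in> carrier_mat a b" "Y \<in> carrier_mat a b"
    for X Y :: "'a poly mat" and a b using that by (intro eq_matI) auto
  have sub: "rat_mat (X - Y) = rat_mat X - rat_mat Y" if "X \<in> carrier_mat a b" "Y \<in> carrier_mat a b"
    for X Y :: "'a poly mat" and a b using that by (intro eq_matI) auto
  have scale: "rat_mat (h \<cdot>\<^sub>m X) = to_fract h \<cdot>\<^sub>m rat_mat X"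
    for X :: "'a poly mat" and h by (intro eq_matI) auto
  have clear: "c \<cdot>\<^sub>m (to_fract g \<cdot>\<^sub>m X) = X" for X :: "'a poly fract mat"
    using cg by (intro eq_matI) (auto simp: mult.assoc[symmetric])
  have bezout': "rat_mat A * Sf + rat_mat B * Tf = 1\<^sub>m n"
  proof -
    have "rat_mat A * Sf + rat_mat B * Tf = c \<cdot>\<^sub>m (rat_mat A * rat_mat S) + c \<cdot>\<^sub>m (rat_mat B * rat_mat T)"
      unfolding Sf_def Tf_def mult_smult_distrib[OF rA rS] mult_smult_distrib[OF rB rT] ..
    also have "\<dots> = c \<cdot>\<^sub>m (rat_mat A * rat_mat S + rat_mat B * rat_mat T)"
      using rA rS rB rT by (intro add_smult_distrib_left_mat[symmetric, of _ n n]) auto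
    also have "\<dots> = c \<cdot>\<^sub>m rat_mat (A * S + B * T)"
      unfolding hom[OF A S, symmetric] hom[OF B T, symmetric]
      by (subst add[OF mult_carrier_mat[OF A S] mult_carrier_mat[OF B T]]) simp
    finally show ?thesis unfolding bezout scale clear to_fract_hom.mat_hom_one .
  qed
  define Y where "Y = MB * W"
  have Y: "Y \<in> carrier_mat n k" using MB W by (simp add: Y_def)
  have rY: "rat_mat Y \<in> carrier_mat n k" using Y by simp
  have Yr: "rat_mat Y = rat_mat MB * rat_mat W" unfolding Y_def by (rule hom[OF MB W])
  define Z where "Z = g \<cdot>\<^sub>m (MD * W) + C * (S * Y) - D * (T * Y)"
  define X where "X = g \<cdot>\<^sub>m U + T * (Y * K)"
  have Z: "Z \<in> carrier_mat p k" and X: "X \<in> carrier_mat m (m + k)"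
    using MD W C S Y D T U K by (auto simp: Z_def X_def)
  have SY: "S * Y \<in> carrier_mat n k" and TY: "T * Y \<in> carrier_mat m k"
    and YK: "Y * K \<in> carrier_mat n (m + k)" using S T Y K by auto
  define Zf where "Zf = rat_mat MD * rat_mat W + rat_mat C * (Sf * rat_mat Y) - rat_mat D * (Tf * rat_mat Y)"
  define Xf where "Xf = rat_mat U + Tf * (rat_mat Y * rat_mat K)"
  have Zf: "Zf \<in> carrier_mat p k" and Xf: "Xf \<in> carrier_mat m (m + k)"
    using rMD rW rC Sf rY rD Tf rU rK by (auto simp: Zf_def Xf_def)
  have cZ: "c \<cdot>\<^sub>m rat_mat Z = Zf"
  proof -
    have "rat_mat Z = to_fract g \<cdot>\<^sub>m (rat_mat MD * rat_mat W) + rat_mat C * (rat_mat S * rat_mat Y)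
        - rat_mat D * (rat_mat T * rat_mat Y)"
      unfolding Z_def
      by (subst sub[of _ p k], (use MD W C S Y D T in auto)[2], subst add[of _ p k], (use MD W C S Y in auto)[2])
        (simp only: scale hom[OF MD W] hom[OF C SY] hom[OF S Y] hom[OF D TY] hom[OF T Y])
    also have "c \<cdot>\<^sub>m \<dots> = rat_mat MD * rat_mat W + c \<cdot>\<^sub>m (rat_mat C * (rat_mat S * rat_mat Y))
        - c \<cdot>\<^sub>m (rat_mat D * (rat_mat T * rat_mat Y))"
      by (subst (2) clear[symmetric], rule eq_matI)
        (use rMD rW rC rS rY rD rT in \<open>auto simp: algebra_simps simp del: index_mult_mat(1)\<close>)
    finally show ?thesis
      unfolding Zf_def Sf_def Tf_def mult_smult_assoc_mat[OF rS rY] mult_smult_assoc_mat[OF rT rY]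
      using mult_smult_distrib[OF rC mult_carrier_mat[OF rS rY]] mult_smult_distrib[OF rD mult_carrier_mat[OF rT rY]]
      by simp
  qed
  have cX: "c \<cdot>\<^sub>m rat_mat X = Xf"
  proof -
    have "rat_mat X = to_fract g \<cdot>\<^sub>m rat_mat U + rat_mat T * (rat_mat Y * rat_mat K)"
      unfolding X_def by (subst add[of _ m "m + k"], (use U T Y K in auto)[2])
        (simp only: scale hom[OF T YK] hom[OF Y K])
    also have "c \<cdot>\<^sub>m \<dots> = c \<cdot>\<^sub>m (to_fract g \<cdot>\<^sub>m rat_mat U) + c \<cdot>\<^sub>m (rat_mat T * (rat_mat Y * rat_mat K))"
      using rU rT rY rK by (intro add_smult_distrib_left_mat[of _ m "m + k"]) auto
    finally show ?thesis
      unfolding clear Xf_def Tf_def mult_smult_assoc_mat[OF rT mult_carrier_mat[OF rY rK]] .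
  qed
  \<comment> \<open>The two transformations, multiplied by \<open>g\<close> to become polynomial.\<close>
  define P1 where "P1 = four_block_mat (g \<cdot>\<^sub>m 1\<^sub>m p) Z (0\<^sub>m k p) (g \<cdot>\<^sub>m 1\<^sub>m k)"
  define P2 where "P2 = X @\<^sub>r (g \<cdot>\<^sub>m K)"
  have P1: "P1 \<in> carrier_mat (p + k) (p + k)" and P2: "P2 \<in> carrier_mat (m + k) (m + k)"
    using X K by (auto simp: P1_def P2_def)
  have dP1: "det P1 = g ^ p * g ^ k"
    unfolding P1_def using Z by (subst det_four_block_mat_lower_left_zero[of _ p _ k]) (auto simp: det_smult_one)
  \<comment> \<open>This factorization separates powers of \<open>g\<close> from the unimodular factor in the determinant of \<open>P2\<close>.\<close>
  have P2_fac: "P2 = four_block_mat (g \<cdot>\<^sub>m 1\<^sub>m m) (T * Y) (0\<^sub>m k m) (g \<cdot>\<^sub>m 1\<^sub>m k) * (U @\<^sub>r K)"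
  proof -
    have "g \<cdot>\<^sub>m 1\<^sub>m m * U + T * Y * K = X"
      unfolding X_def assoc_mult_mat[OF T Y K] using mult_smult_assoc_mat[of "1\<^sub>m m" m m U] U by simp
    moreover have "0\<^sub>m k m * U + g \<cdot>\<^sub>m 1\<^sub>m k * K = g \<cdot>\<^sub>m K"
      using mult_smult_assoc_mat[of "1\<^sub>m k" k k K] U K by simp
    ultimately show ?thesis
      unfolding P2_def
      using four_block_mult_append_rows[OF _ TY zero_carrier_mat[of k m] _ U K, of "g \<cdot>\<^sub>m 1\<^sub>m m" "g \<cdot>\<^sub>m 1\<^sub>m k"] by simp
  qed
  have "(U @\<^sub>r K) * (Nt @\<^sub>c W) = 1\<^sub>m (m + k)"
    unfolding append_rows_mult_append_cols[OF U K Nt W] UN UW KN KW by simp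
  hence "det (U @\<^sub>r K) * det (Nt @\<^sub>c W) = 1"
    using det_mult[of "U @\<^sub>r K" "m + k" "Nt @\<^sub>c W"] U K Nt W by simp
  hence dUK: "poly (det (U @\<^sub>r K)) x \<noteq> 0" for x
    by (metis mult_zero_left poly_1 poly_mult zero_neq_one)
  have dP2: "det P2 = g ^ m * g ^ k * det (U @\<^sub>r K)"
    unfolding P2_fac using TY U K
    by (subst det_mult[of _ "m + k"]) (auto simp: det_four_block_mat_lower_left_zero[of _ m _ k] det_smult_one)
  define R1 where "R1 = c \<cdot>\<^sub>m rat_mat P1"
  define R2 where "R2 = c \<cdot>\<^sub>m rat_mat P2"
  have R1c: "R1 \<in> carrier_mat (p + k) (p + k)" and R2c: "R2 \<in> carrier_mat (m + k) (m + k)"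
    using P1 P2 by (auto simp: R1_def R2_def)
  have reg1: "regular_in \<Omega> R1"
    unfolding R1_def c_def by (rule regular_in_scaled[OF P1 g(2)]) (use g(2) in \<open>auto simp: dP1\<close>)
  have reg2: "regular_in \<Omega> R2"
    unfolding R2_def c_def by (rule regular_in_scaled[OF P2 g(2)]) (use g(2) dUK in \<open>auto simp: dP2\<close>)
  have R1: "R1 = four_block_mat (1\<^sub>m p) Zf (0\<^sub>m k p) (1\<^sub>m k)"
    unfolding R1_def P1_def cZ[symmetric] using Z cg by (intro eq_matI) auto
  have R2: "R2 = Xf @\<^sub>r rat_mat K"
    unfolding R2_def P2_def cX[symmetric] using X K cg
    by (intro eq_matI) (auto simp: append_rows_def mult.assoc[symmetric])
  define R where "R = transfer_function A B C D"
  have Rd: "R = rat_mat D + rat_mat C * (Ai * rat_mat B)"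
    unfolding R_def transfer_function_def Ai_def[symmetric] using assoc_mult_mat[OF rC Ai(1) rB] by simp
  have R: "R \<in> carrier_mat p m" using rD rC Ai rB by (auto simp: Rd)
  have comp': "rat_mat Nt * rat_mat U + rat_mat W * rat_mat K = 1\<^sub>m (m + k)"
    unfolding hom[OF Nt U, symmetric] hom[OF W K, symmetric]
      add[OF mult_carrier_mat[OF Nt U] mult_carrier_mat[OF W K], symmetric] comp to_fract_hom.mat_hom_one ..
  have main: "R * Xf + Zf * rat_mat K = rat_mat MD + rat_mat C * (Ai * rat_mat MB)"
    unfolding Xf_def
    by (rule equivalence_identity[OF rA Ai(1) rB rC rD rMB rMD rK rN rU rW Sf Tf _ _ comp' Ai(3) bezout' Yr Zf_def Rd])
      (simp_all add: hom[OF MD Nt, symmetric] hom[OF MB Nt, symmetric] Dd Bd)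
  have "R1 * four_block_mat R (0\<^sub>m p k) (0\<^sub>m k m) (1\<^sub>m k) = four_block_mat R Zf (0\<^sub>m k m) (1\<^sub>m k)"
  proof -
    have "1\<^sub>m p * R + Zf * 0\<^sub>m k m = R" "1\<^sub>m p * 0\<^sub>m p k + Zf * 1\<^sub>m k = Zf"
      "0\<^sub>m k p * R + 1\<^sub>m k * 0\<^sub>m k m = 0\<^sub>m k m" "0\<^sub>m k p * 0\<^sub>m p k + 1\<^sub>m k * 1\<^sub>m k = (1\<^sub>m k :: 'a poly fract mat)"
      using R Zf by auto
    thus ?thesis unfolding R1
      by (simp only: mult_four_block_mat[OF one_carrier_mat Zf zero_carrier_mat one_carrier_mat
        R zero_carrier_mat zero_carrier_mat one_carrier_mat])
  qed
  hence "R1 * four_block_mat R (0\<^sub>m p k) (0\<^sub>m k m) (1\<^sub>m k) * R2 =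
      (R * Xf + Zf * rat_mat K) @\<^sub>r (0\<^sub>m k m * Xf + 1\<^sub>m k * rat_mat K)"
    unfolding R2 by (simp only: four_block_mult_append_rows[OF R Zf zero_carrier_mat one_carrier_mat Xf rK])
  also have "0\<^sub>m k m * Xf + 1\<^sub>m k * rat_mat K = rat_mat K" using Xf rK by simp
  finally have "R1 * four_block_mat R (0\<^sub>m p k) (0\<^sub>m k m) (1\<^sub>m k) * R2 =
      (rat_mat MD + rat_mat C * (Ai * rat_mat MB)) @\<^sub>r rat_mat K" unfolding main .
  thus ?thesis using R1c R2c reg1 reg2 unfolding R_def Ai_def by blast
qed

section \<open>The linearization theorem\<close>

theorem theorem3p4:
  fixes R :: "'a::alg_closed_field poly fract mat"
    and A B C D M_A K_A N_A M_D K_D N_D M_B M_C :: "'a poly mat"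
    and n m p k_A k_D :: nat
    and \<Omega> :: "'a set"
  assumes "R \<in> carrier_mat p m"
    and "A \<in> carrier_mat n n" and "det A \<noteq> 0"
    and "B \<in> carrier_mat n m" and "C \<in> carrier_mat p n" and "D \<in> carrier_mat p m"
    and "R = transfer_function A B C D"
    and "M_A \<in> carrier_mat n (n + k_A)" and "K_A \<in> carrier_mat k_A (n + k_A)"
    and "M_D \<in> carrier_mat p (m + k_D)" and "K_D \<in> carrier_mat k_D (m + k_D)"
    and "block_minimal_basis_linearization M_A K_A N_A A"
    and "block_minimal_basis_linearization M_D K_D N_D D"
    and "M_C \<in> carrier_mat p (n + k_A)" and "linear_poly_mat M_C"
    and "M_B \<in> carrier_mat n (m + k_D)" and "linear_poly_mat M_B"
    and "M_C * N_A\<^sup>T = C" and "M_B * N_D\<^sup>T = B"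
    and "no_eigenvalues_in \<Omega> (A @\<^sub>r C)" and "no_eigenvalues_in \<Omega> (A @\<^sub>c B)"
  shows "linearization_in \<Omega> (n + k_A)
    (four_block_mat
      (M_A @\<^sub>r K_A) (M_B @\<^sub>r 0\<^sub>m k_A (m + k_D))
      ((- M_C) @\<^sub>r 0\<^sub>m k_D (n + k_A)) (M_D @\<^sub>r K_D))
    R"
proof -
  note R = assms(1) and A = assms(2) and dA = assms(3) and B = assms(4) and C = assms(5) and D = assms(6)
    and MA = assms(8) and KA = assms(9) and MD = assms(10) and KD = assms(11)
    and MC = assms(14) and MB = assms(16) and MCN = assms(18) and MBN = assms(19)
  have linA: "linear_poly_mat (M_A @\<^sub>r K_A)" and dualA: "dual_minimal_bases K_A N_A" and MAN: "M_A * N_A\<^sup>T = A"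
    and linD: "linear_poly_mat (M_D @\<^sub>r K_D)" and dualD: "dual_minimal_bases K_D N_D" and MDN: "M_D * N_D\<^sup>T = D"
    using assms(12,13) unfolding block_minimal_basis_linearization_def block_minimal_basis_pencil_def by auto
  obtain UA WA where UA: "UA \<in> carrier_mat n (n + k_A)" and WA: "WA \<in> carrier_mat (n + k_A) k_A"
    and NA: "N_A \<in> carrier_mat n (n + k_A)" and KNA: "K_A * N_A\<^sup>T = 0\<^sub>m k_A n" and KWA: "K_A * WA = 1\<^sub>m k_A"
    and compA: "N_A\<^sup>T * UA + WA * K_A = 1\<^sub>m (n + k_A)"
    using dual_minimal_bases_completion[OF dualA KA] by blast
  obtain UD WD where UD: "UD \<in> carrier_mat m (m + k_D)" and WD: "WD \<in> carrier_mat (m + k_D) k_D"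
    and ND: "N_D \<in> carrier_mat m (m + k_D)" and KND: "K_D * N_D\<^sup>T = 0\<^sub>m k_D m"
    and UND: "UD * N_D\<^sup>T = 1\<^sub>m m" and UWD: "UD * WD = 0\<^sub>m m k_D" and KWD: "K_D * WD = 1\<^sub>m k_D"
    and compD: "N_D\<^sup>T * UD + WD * K_D = 1\<^sub>m (m + k_D)"
    using dual_minimal_bases_completion[OF dualD KD] by blast
  have NAt: "N_A\<^sup>T \<in> carrier_mat (n + k_A) n" and NDt: "N_D\<^sup>T \<in> carrier_mat (m + k_D) m" using NA ND by auto
  obtain S T g where
    S: "S \<in> carrier_mat n n" and T: "T \<in> carrier_mat m n" and bezout: "A * S + B * T = g \<cdot>\<^sub>m 1\<^sub>m n"
    and g0: "g \<noteq> 0" and g_ball: "\<forall>x\<in>\<Omega>. poly g x \<noteq> 0"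
    by (rule bezout_identity[OF A dA B assms(21)])
  have g: "poly g x \<noteq> 0" if "x \<in> \<Omega>" for x using g_ball that by blast
  define LA where "LA = M_A @\<^sub>r K_A"
  define LB where "LB = M_B @\<^sub>r 0\<^sub>m k_A (m + k_D)"
  define LC where "LC = M_C @\<^sub>r 0\<^sub>m k_D (n + k_A)"
  define LD where "LD = M_D @\<^sub>r K_D"
  have LAc: "LA \<in> carrier_mat (n + k_A) (n + k_A)" and LBc: "LB \<in> carrier_mat (n + k_A) (m + k_D)"
    and LCc: "LC \<in> carrier_mat (p + k_D) (n + k_A)" and LDc: "LD \<in> carrier_mat (p + k_D) (m + k_D)"
    using MA KA MB MC MD KD by (auto simp: LA_def LB_def LC_def LD_def)
  have mLC: "- LC = (- M_C) @\<^sub>r 0\<^sub>m k_D (n + k_A)"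
    unfolding LC_def using MC by (intro eq_matI) (auto simp: append_rows_def)
  have dLA: "det LA \<noteq> 0"
    unfolding LA_def by (rule pencil_det_nonzero[OF MA KA NAt WA KNA KWA]) (simp add: MAN dA)
  \<comment> \<open>A minimal basis has fewer rows than columns, so here \<open>n\<close> is positive.\<close>
  have pos: "0 < n + k_A"
    using dualA KA unfolding dual_minimal_bases_def minimal_basis_def by auto
  have sys: "is_system_matrix (n + k_A) (p + k_D) (m + k_D) LA LB LC LD"
    unfolding is_system_matrix_def using pos LAc LBc LCc LDc dLA by blast
  have L: "four_block_mat (M_A @\<^sub>r K_A) (M_B @\<^sub>r 0\<^sub>m k_A (m + k_D)) ((- M_C) @\<^sub>r 0\<^sub>m k_D (n + k_A)) (M_D @\<^sub>r K_D)
      = system_matrix LA LB LC LD"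
    unfolding system_matrix_def mLC LA_def LB_def LD_def ..
  have linC: "linear_poly_mat (- M_C)" using assms(15) unfolding linear_poly_mat_def by auto
  have lin: "linear_poly_mat (system_matrix LA LB LC LD)"
    unfolding system_matrix_def
  proof (rule linear_poly_mat_four_block[OF LAc LBc _ LDc])
    show "- LC \<in> carrier_mat (p + k_D) (n + k_A)" using LCc by simp
    show "linear_poly_mat LB" unfolding LB_def by (rule linear_poly_mat_append_rows_zero[OF MB assms(17)])
    show "linear_poly_mat (- LC)"
      unfolding mLC by (rule linear_poly_mat_append_rows_zero[OF _ linC]) (use MC in simp)
  qed (use linA linD in \<open>simp_all add: LA_def LD_def\<close>)
  have "no_eigenvalues_in \<Omega> (LA @\<^sub>r LC)"
    unfolding LA_def LC_def by (rule pencil_observable[OF MA KA MC NAt UA WA compA MAN MCN dA assms(20)])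
  moreover have "no_eigenvalues_in \<Omega> (LA @\<^sub>c LB)"
    unfolding LA_def LB_def
    by (rule pencil_controllable[OF MA KA NAt WA MB NDt KNA KWA MAN MBN S T bezout g])
  ultimately have min: "minimal_in \<Omega> LA LB LC" unfolding minimal_in_def by blast
  have rA: "rat_mat A \<in> carrier_mat n n" and rL: "rat_mat LA \<in> carrier_mat (n + k_A) (n + k_A)"
    using A LAc by auto
  have "det (rat_mat A) \<noteq> 0" "det (rat_mat LA) \<noteq> 0" using dA dLA by simp_all
  note Ai = mat_inverse_det_nonzero[OF rA this(1)] and Li = mat_inverse_det_nonzero[OF rL this(2)]
  have rzero: "rat_mat (0\<^sub>m a b :: 'a poly mat) = 0\<^sub>m a b" for a b by (intro eq_matI) auto
  have "transfer_function LA LB LC LD =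
      (rat_mat M_D @\<^sub>r rat_mat K_D) + (rat_mat M_C @\<^sub>r 0\<^sub>m k_D (n + k_A)) *
        the (mat_inverse (rat_mat LA)) * (rat_mat M_B @\<^sub>r 0\<^sub>m k_A (m + k_D))"
    unfolding transfer_function_def LB_def LC_def LD_def map_append_rows[OF MD KD]
      map_append_rows[OF MC zero_carrier_mat] map_append_rows[OF MB zero_carrier_mat] rzero ..
  also have "\<dots> = (rat_mat M_D + rat_mat C * (the (mat_inverse (rat_mat A)) * rat_mat M_B)) @\<^sub>r rat_mat K_D"
  proof (rule transfer_function_reduction[where Nt = "rat_mat (N_A\<^sup>T)" and MA = "rat_mat M_A" and KA = "rat_mat K_A"])
    show "rat_mat M_A * rat_mat (N_A\<^sup>T) = rat_mat A"
      unfolding to_fract_hom.mat_hom_mult[OF MA NAt, symmetric] MAN ..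
    show "rat_mat K_A * rat_mat (N_A\<^sup>T) = 0\<^sub>m k_A n"
      unfolding to_fract_hom.mat_hom_mult[OF KA NAt, symmetric] KNA rzero ..
    show "rat_mat M_C * rat_mat (N_A\<^sup>T) = rat_mat C"
      unfolding to_fract_hom.mat_hom_mult[OF MC NAt, symmetric] MCN ..
    show "the (mat_inverse (rat_mat LA)) * (rat_mat M_A @\<^sub>r rat_mat K_A) = 1\<^sub>m (n + k_A)"
      using Li(3) unfolding LA_def map_append_rows[OF MA KA] .
  qed (use MA KA MB MC MD KD NA rA Ai Li in simp_all)
  finally have TF: "transfer_function LA LB LC LD =
      (rat_mat M_D + rat_mat C * (the (mat_inverse (rat_mat A)) * rat_mat M_B)) @\<^sub>r rat_mat K_D" .
  have "\<exists>R1 \<in> carrier_mat (p + k_D) (p + k_D). \<exists>R2 \<in> carrier_mat (m + k_D) (m + k_D).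
      regular_in \<Omega> R1 \<and> regular_in \<Omega> R2 \<and>
      R1 * four_block_mat R (0\<^sub>m p k_D) (0\<^sub>m k_D m) (1\<^sub>m k_D) * R2 = transfer_function LA LB LC LD"
    unfolding TF assms(7)
    by (rule transfer_equivalence[OF A dA B C D MB MD KD NDt UD WD S T MDN MBN UND UWD KND KWD compD bezout g0 g])
  moreover have "dim_row R = p" "dim_col R = m" using R by auto
  ultimately show ?thesis
    unfolding linearization_in_def L using sys lin min by blast
qed

end
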